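(* Let $A\in\mathbb{R}^{n\times n}$ and let $B=[\,\mathbf{r}^{(0)},\,AV_k\,]$ be the Arnoldi matrix whose $QR$ factorization is computed, in floating-point arithmetic with machine precision $\varepsilon$, by the modified Gram-Schmidt (MGS) algorithm within $k$ steps of MGS-GMRES with $\mathbf{x}^{(0)}=0$ and $\mathbf{r}^{(0)}=\mathbf{b}$. Let $\tilde V_k$ be the matrix of properly normalized computed Krylov vectors, and let $\tilde L_k$ be the strictly lower triangular part of $\tilde V_k^T\tilde V_k$, so that $\tilde V_k^T\tilde V_k=I+\tilde L_k+\tilde L_k^T$. Then $$\|\tilde L_k\|_F\le \mathcal{O}(\varepsilon)\,\tilde\kappa_F(B),\qquad \|\tilde L_k\|_F^p\le \mathcal{O}(\varepsilon^p)\,\tilde\kappa_F^p(B),$$ and the correction matrix $T_k=(I+\tilde L_k)^{-1}$ satisfies $$T_k=(I+\tilde L_k)^{-1}=I-\tilde L_k+\mathcal{O}(\varepsilon^2)\,\kappa^2(B).$$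
   Context: Arnoldi/MGS setting: with $\mathbf{v}_1=\mathbf{b}/\|\mathbf{b}\|_2$, in exact arithmetic $k$ steps of the Arnoldi algorithm give $AV_k=V_{k+1}H_{k+1,k}$ with $V_{k+1}^TV_{k+1}=I_{k+1}$ and $H_{k+1,k}$ upper Hessenberg of size $(k+1)\times k$; equivalently, $B=[\mathbf{r}^{(0)},AV_k]=V_{k+1}[\,\mathbf{e}_1\rho,\;H_{k+1,k}\,]$ with $\rho=\|\mathbf{b}\|_2$, a $QR$ factorization of $B$. In MGS each new column of $B$ is successively orthogonalized against the previously computed vectors $\mathbf{v}_1,\mathbf{v}_2,\dots$ (subtracting from the current, already updated, vector its component along $\mathbf{v}_j$, for $j=1,2,\dots$ in order) and is then normalized. In finite precision the computed vectors form the columns of $\bar V_k$, and $\tilde V_k$ denotes the matrix whose columns are the columns of $\bar V_k$ normalized to have exactly unit 2-norm. Condition numbers: $\kappa(B)=\sigma_{\max}(B)/\sigma_{\min}(B)$, and $\tilde\kappa_F(B)=\min_{D}\|BD\|_F/\sigma_{\min}(BD)$, where the minimum is over all positive definite diagonal matrices $D$ and $\sigma_{\max},\sigma_{\min}$ are the largest and smallest singular values. The constants in $\mathcal{O}(\cdot)$ may depend on the dimensions ($n$, $k$, and the exponent $p$), but not on $\varepsilon$ or $B$. The floating-point setting is the usual one for the MGS backward-error analysis of Paige, Rozložník and Strakoš: the standard model of floating-point arithmetic with unit roundoff $\varepsilon$, with $\tilde c_n\varepsilon<1$ and $\hat\gamma_n=\tilde c_n\varepsilon/(1-\tilde c_n\varepsilon)$,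 where $\tilde c_n$ is a constant depending only on $n$. In their result, the loss of orthogonality for MGS satisfies $\|I-\tilde V_k^T\tilde V_k\|\le\tfrac43(2m)^{1/2}\hat\gamma_n\tilde\kappa_F(B)$, where $m$ is the number of columns. The $\mathcal{O}(\varepsilon^2)\kappa^2(B)$ term in the last identity denotes a matrix whose norm is bounded by such a constant times $\varepsilon^2\kappa^2(B)$. *)

theory Defs
  imports
    Complex_Main
    "HOL-Library.Multiset"
    "Jordan_Normal_Form.Matrix"
    "Jordan_Normal_Form.Char_Poly"
    "Jordan_Normal_Form.Gauss_Jordan_Elimination"
begin

definition norm2 :: "real vec \<Rightarrow> real" where
  "norm2 v = sqrt (v \<bullet> v)"

definition frob_norm :: "real mat \<Rightarrow> real" where
  "frob_norm M = sqrt (\<Sum>i<dim_row M. \<Sum>j<dim_col M. (M $$ (i, j))\<^sup>2)"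

text \<open>
  Singular values are counted by columns, as the square roots of the eigenvalues of the Gram
  matrix. Hence the smallest one is nonzero exactly for matrices of full column rank; in
  particular it is zero for a matrix with more columns than rows.
\<close>

definition singular_values :: "real mat \<Rightarrow> real set" where
  "singular_values M = sqrt ` {l. eigenvalue (transpose_mat M * M) l}"

definition sigma_max :: "real mat \<Rightarrow> real" where
  "sigma_max M = Max (singular_values M)"

definition sigma_min :: "real mat \<Rightarrow> real" where
  "sigma_min M = Min (singular_values M)"

definition cond_num :: "real mat \<Rightarrow> real" where
  "cond_num M = sigma_max M / sigma_min M"

text \<open>A real diagonal matrix is positive definite iff its diagonal entries are positive.\<close>

definition pos_diag_mats :: "nat \<Rightarrow> real mat set" where
  "pos_diag_mats m = {D \<in> carrier_mat m m. diagonal_mat D \<and> (\<forall>i<m. D $$ (i, i) > 0)}"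

text \<open>
  The minimum over all column scalings is written as an infimum. For \<^term>\<open>M\<close> of full column
  rank it is attained (the quotient is invariant under positive multiples of \<^term>\<open>D\<close> and tends
  to infinity when the ratio of two diagonal entries degenerates).
\<close>

definition scaled_cond_num :: "real mat \<Rightarrow> real" where
  "scaled_cond_num M =
     (INF D \<in> pos_diag_mats (dim_col M). frob_norm (M * D) / sigma_min (M * D))"


text \<open>
  Standard model of floating-point arithmetic with unit roundoff \<open>\<epsilon>\<close>:
  \<open>fl(x op y) = (x op y)(1 + \<delta>)\<close> with \<open>\<bar>\<delta>\<bar> \<le> \<epsilon>\<close>. It is used as a relation between the exact result
  of one operation and an admissible computed result, so that every execution of an algorithm on
  an arithmetic obeying the model is an instance of the relations below.
\<close>

definition fl_rounds :: "real \<Rightarrow> real \<Rightarrow> real \<Rightarrow> bool" where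
  "fl_rounds \<epsilon> x y \<longleftrightarrow> (\<exists>\<delta>. \<bar>\<delta>\<bar> \<le> \<epsilon> \<and> y = x * (1 + \<delta>))"

text \<open>Computed sum of finitely many numbers, added up in an arbitrary order.\<close>

inductive fl_sum :: "real \<Rightarrow> real multiset \<Rightarrow> real \<Rightarrow> bool" for \<epsilon> where
  single: "fl_sum \<epsilon> {#x#} x"
| add: "fl_sum \<epsilon> M x \<Longrightarrow> fl_sum \<epsilon> N y \<Longrightarrow> fl_rounds \<epsilon> (x + y) z \<Longrightarrow> fl_sum \<epsilon> (M + N) z"

definition fl_dot :: "real \<Rightarrow> real vec \<Rightarrow> real vec \<Rightarrow> real \<Rightarrow> bool" where
  "fl_dot \<epsilon> x y s \<longleftrightarrow> dim_vec x = dim_vec y \<and>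
     (\<exists>t. (\<forall>i<dim_vec x. fl_rounds \<epsilon> (x $ i * y $ i) (t i)) \<and>
          fl_sum \<epsilon> (image_mset t (mset_set {..<dim_vec x})) s)"

definition fl_norm2 :: "real \<Rightarrow> real vec \<Rightarrow> real \<Rightarrow> bool" where
  "fl_norm2 \<epsilon> x r \<longleftrightarrow> (\<exists>s. fl_dot \<epsilon> x x s \<and> fl_rounds \<epsilon> (sqrt s) r)"

definition fl_mult_mat_vec :: "real \<Rightarrow> real mat \<Rightarrow> real vec \<Rightarrow> real vec \<Rightarrow> bool" where
  "fl_mult_mat_vec \<epsilon> A v w \<longleftrightarrow> dim_vec w = dim_row A \<and>
     (\<forall>i<dim_row A. fl_dot \<epsilon> (row A i) v (w $ i))"

text \<open>\<open>fl_sub_smult \<epsilon> w h v w'\<close>: the vector \<open>w'\<close> is a computed value of \<open>w - h v\<close>.\<close>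

definition fl_sub_smult :: "real \<Rightarrow> real vec \<Rightarrow> real \<Rightarrow> real vec \<Rightarrow> real vec \<Rightarrow> bool" where
  "fl_sub_smult \<epsilon> w h v w' \<longleftrightarrow> dim_vec v = dim_vec w \<and> dim_vec w' = dim_vec w \<and>
     (\<forall>i<dim_vec w. \<exists>t. fl_rounds \<epsilon> (h * v $ i) t \<and> fl_rounds \<epsilon> (w $ i - t) (w' $ i))"

definition fl_normalize :: "real \<Rightarrow> real vec \<Rightarrow> real vec \<Rightarrow> bool" where
  "fl_normalize \<epsilon> u v \<longleftrightarrow> dim_vec v = dim_vec u \<and>
     (\<exists>r. fl_norm2 \<epsilon> u r \<and> r \<noteq> 0 \<and> (\<forall>i<dim_vec u. fl_rounds \<epsilon> (u $ i / r) (v $ i)))"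

text \<open>
  \<open>fl_mgs \<epsilon> V w u\<close>: starting from \<open>w\<close>, the components along the vectors of the list \<open>V\<close> are
  subtracted one after the other, each coefficient being computed from the vector already
  updated, and the final vector is \<open>u\<close>.
\<close>

inductive fl_mgs :: "real \<Rightarrow> real vec list \<Rightarrow> real vec \<Rightarrow> real vec \<Rightarrow> bool" for \<epsilon> where
  Nil: "fl_mgs \<epsilon> [] w w"
| Cons: "fl_dot \<epsilon> v w h \<Longrightarrow> fl_sub_smult \<epsilon> w h v w' \<Longrightarrow> fl_mgs \<epsilon> V w' u
    \<Longrightarrow> fl_mgs \<epsilon> (v # V) w u"

text \<open>
  \<open>fl_arnoldi \<epsilon> A b k V W\<close>: the first \<open>k\<close> steps of MGS-GMRES with zero initial guess (so that the
  initial residual is \<open>b\<close>) can be carried out in floating-point arithmetic without breakdown, with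
  computed Krylov vectors \<open>V\<close> (\<open>k + 1\<close> of them) and computed products \<open>W\<close> of \<open>A\<close> with the first \<open>k\<close>
  of these.
\<close>

inductive fl_arnoldi ::
  "real \<Rightarrow> real mat \<Rightarrow> real vec \<Rightarrow> nat \<Rightarrow> real vec list \<Rightarrow> real vec list \<Rightarrow> bool"
  for \<epsilon> A b where
  start: "fl_normalize \<epsilon> b v \<Longrightarrow> fl_arnoldi \<epsilon> A b 0 [v] []"
| step: "fl_arnoldi \<epsilon> A b k V W \<Longrightarrow> fl_mult_mat_vec \<epsilon> A (last V) w \<Longrightarrow> fl_mgs \<epsilon> V w u
    \<Longrightarrow> fl_normalize \<epsilon> u v \<Longrightarrow> fl_arnoldi \<epsilon> A b (Suc k) (V @ [v]) (W @ [w])"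

text \<open>
  The matrix \<open>[r\<^sup>(\<^sup>0\<^sup>), A V\<^sub>k]\<close> to which the computed MGS factorization is applied: its trailing columns
  are the products with \<open>A\<close> as they enter the orthogonalization, that is, as computed. (Products
  formed without error are the instance in which all relative errors in them vanish.)
\<close>

definition arnoldi_mat :: "real vec \<Rightarrow> real vec list \<Rightarrow> real mat" where
  "arnoldi_mat b W = mat_of_cols (dim_vec b) (b # W)"

definition unit_vec_of :: "real vec \<Rightarrow> real vec" where
  "unit_vec_of v = (1 / norm2 v) \<cdot>\<^sub>v v"

definition normalized_krylov_mat :: "nat \<Rightarrow> nat \<Rightarrow> real vec list \<Rightarrow> real mat" where
  "normalized_krylov_mat n k V = mat_of_cols n (map unit_vec_of (take k V))"

definition strict_lower_part :: "real mat \<Rightarrow> real mat" where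
  "strict_lower_part M =
     mat (dim_row M) (dim_col M) (\<lambda>(i, j). if j < i then M $$ (i, j) else 0)"

end

theory Submission
  imports Defs "HOL-Analysis.L2_Norm" "HOL-Analysis.Function_Topology"
begin

text \<open>
  Let \<open>a\<^sub>j\<close> be the columns of \<open>B\<close> and \<open>q\<^sub>l\<close> the normalised computed vectors. A rounding error
  analysis of modified Gram-Schmidt gives two estimates for each column, both relative to the
  norm of that column. First, \<open>B = Q R + F\<close> with an upper triangular \<open>R\<close> and a small \<open>F\<close>. Second,
  after the component along \<open>q\<^sub>i\<close> has been removed, only the later subtractions along \<open>q\<^sub>l\<close>, \<open>l > i\<close>,
  bring such a component back; hence \<open>U R = G\<close> with \<open>U\<close> the strict upper triangle of \<open>Q\<^sup>T Q\<close> and a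
  small \<open>G\<close>. Both are collected in \<open>mgs_column_error\<close>.

  Consequently \<open>U = (G D) (R D)\<^sup>-\<^sup>1\<close> for every diagonal scaling \<open>D\<close>. Here \<open>\<parallel>G D\<parallel>\<close> is of the order of
  \<open>\<epsilon> \<parallel>B D\<parallel>\<^sub>F\<close>, and \<open>R D\<close> inherits its smallest singular value from \<open>B D\<close>, because \<open>B D \<approx> Q R D\<close> and
  \<open>Q\<close> has unit columns. So each entry of \<open>U\<close> is at most a constant times
  \<open>\<epsilon> \<parallel>B D\<parallel>\<^sub>F / \<sigma>\<^sub>m\<^sub>i\<^sub>n(B D)\<close>. When this quantity is not small, the bound holds trivially, as entries of
  \<open>U\<close> are inner products of unit vectors. This is \<open>loss_of_orthogonality\<close>; the infimum over \<open>D\<close> gives the first two claims for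
  \<open>L = U\<^sup>T\<close>, restricted to the first \<open>k\<close> vectors.

  The inverse \<open>T\<close> of \<open>I + L\<close> satisfies \<open>T = I - L + T L\<^sup>2\<close> exactly. Since the entries of \<open>L\<close> are at
  most \<open>1\<close>, forward substitution bounds \<open>T\<close> by a constant depending on \<open>k\<close> only, and the scaled
  condition number is at most \<open>sqrt (k + 1) \<kappa>(B)\<close>; this gives the expansion.

  Vectors are handled through their coordinate functions, with norms given by \<^const>\<open>L2_set\<close>.
\<close>

section \<open>Euclidean norm and inner product on coordinate functions\<close>

abbreviation nrm :: "nat \<Rightarrow> (nat \<Rightarrow> real) \<Rightarrow> real" where
  "nrm n x \<equiv> L2_set x {..<n}"

definition ip :: "nat \<Rightarrow> (nat \<Rightarrow> real) \<Rightarrow> (nat \<Rightarrow> real) \<Rightarrow> real" where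
  "ip n x y = (\<Sum>i<n. x i * y i)"

lemma ip_self: "ip n x x = (nrm n x)\<^sup>2"
  by (simp add: ip_def L2_set_def sum_nonneg power2_eq_square)

lemma nrm_sq: "(nrm n x)\<^sup>2 = (\<Sum>i<n. (x i)\<^sup>2)"
  by (simp add: L2_set_def sum_nonneg)

lemma ip_bound: "\<bar>ip n x y\<bar> \<le> nrm n x * nrm n y"
proof -
  have "\<bar>ip n x y\<bar> \<le> (\<Sum>i<n. \<bar>x i\<bar> * \<bar>y i\<bar>)"
    unfolding ip_def by (rule order_trans[OF sum_abs]) (simp add: abs_mult)
  then show ?thesis using L2_set_mult_ineq[of x y "{..<n}"] by linarith
qed

lemma ip_add_right: "ip n x (\<lambda>i. y i + z i) = ip n x y + ip n x z"
  by (simp add: ip_def algebra_simps sum.distrib)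

lemma ip_diff_right: "ip n x (\<lambda>i. y i - z i) = ip n x y - ip n x z"
  by (simp add: ip_def algebra_simps sum_subtractf)

lemma ip_diff_left: "ip n (\<lambda>i. y i - z i) x = ip n y x - ip n z x"
  by (simp add: ip_def algebra_simps sum_subtractf)

lemma ip_scale_right: "ip n x (\<lambda>i. c * y i) = c * ip n x y"
  by (simp add: ip_def sum_distrib_left mult.left_commute)

lemma ip_sum_right: "ip n x (\<lambda>i. \<Sum>j\<in>J. f j i) = (\<Sum>j\<in>J. ip n x (f j))"
  unfolding ip_def sum_distrib_left by (rule sum.swap)

lemma nrm_mono: "(\<And>i. i < n \<Longrightarrow> \<bar>x i\<bar> \<le> \<bar>y i\<bar>) \<Longrightarrow> nrm n x \<le> nrm n y"
  unfolding L2_set_def by (auto intro!: sum_mono simp: abs_le_square_iff)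

lemma nrm_scale: "nrm n (\<lambda>i. c * x i) = \<bar>c\<bar> * nrm n x"
  unfolding L2_set_def
  by (simp add: power_mult_distrib sum_distrib_left[symmetric] real_sqrt_mult)

lemma nrm_abs: "nrm n (\<lambda>i. \<bar>x i\<bar>) = nrm n x"
  by (simp add: L2_set_def)

lemma nrm_triangle: "nrm n (\<lambda>i. x i + y i) \<le> nrm n x + nrm n y"
  by (rule L2_set_triangle_ineq)

lemma nrm_minus_commute: "nrm n (\<lambda>i. x i - y i) = nrm n (\<lambda>i. y i - x i)"
  by (simp add: L2_set_def power2_commute)

lemma nrm_triangle_diff: "nrm n (\<lambda>i. x i - y i) \<le> nrm n x + nrm n y"
  using nrm_triangle[of x "\<lambda>i. - y i" n] by (simp add: L2_set_def)

lemma nrm_dist_triangle: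
  "nrm n (\<lambda>i. x i - z i) \<le> nrm n (\<lambda>i. x i - y i) + nrm n (\<lambda>i. y i - z i)"
  using nrm_triangle[of "\<lambda>i. x i - y i" "\<lambda>i. y i - z i" n] by simp

lemma nrm_le_dist: "nrm n x \<le> nrm n y + nrm n (\<lambda>i. x i - y i)"
  using nrm_triangle[of y "\<lambda>i. x i - y i" n] by simp

lemma nrm_sum: "nrm n (\<lambda>i. \<Sum>j\<in>J. f j i) \<le> (\<Sum>j\<in>J. nrm n (f j))"
proof (induction J rule: infinite_finite_induct)
  case (insert a J)
  then show ?case
    using nrm_triangle[of "f a" "\<lambda>i. \<Sum>j\<in>J. f j i" n] by auto
qed (auto simp: L2_set_def)

lemma coord_le_nrm: "i < n \<Longrightarrow> \<bar>x i\<bar> \<le> nrm n x"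
  using member_le_L2_set[of "{..<n}" i "\<lambda>i. \<bar>x i\<bar>"] by (simp add: nrm_abs)

lemma nrm_pos: "i < n \<Longrightarrow> x i \<noteq> 0 \<Longrightarrow> 0 < nrm n x"
  using coord_le_nrm[of i n x] by linarith

lemma sum_abs_le_nrm: "(\<Sum>i<n. \<bar>x i\<bar>) \<le> sqrt n * nrm n x"
  using L2_set_mult_ineq[of "\<lambda>_. 1" x "{..<n}"] by (simp add: L2_set_constant)

lemma norm2_eq_nrm: "norm2 v = nrm (dim_vec v) (($) v)"
  by (simp add: norm2_def L2_set_def scalar_prod_def power2_eq_square atLeast0LessThan)

section \<open>Extreme eigenvalues of Gram matrices\<close>

text \<open>The Rayleigh quotient attains its minimum by compactness of the unit sphere, and at a
  minimiser \<open>x\<close> the shifted form \<open>y \<mapsto> y\<^sup>T G y - l y\<^sup>T y\<close> is nonnegative and vanishes, so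
  its gradient \<open>2 (G x - l x)\<close> vanishes too: the minimum is an eigenvalue.\<close>

lemma min_rayleigh_attained:
  fixes g :: "nat \<Rightarrow> nat \<Rightarrow> real"
  assumes m: "0 < m"
  shows "\<exists>x l. nrm m x = 1 \<and> ip m x (\<lambda>i. ip m (g i) x) = l \<and>
     (\<forall>y. l * (nrm m y)\<^sup>2 \<le> ip m y (\<lambda>i. ip m (g i) y))"
proof -
  define q where "q y = ip m y (\<lambda>i. ip m (g i) y)" for y
  define P :: "(nat \<Rightarrow> real) set" where "P = (\<Pi>\<^sub>E i\<in>UNIV. if i < m then {-1..1} else {0})"
  define S where "S = P \<inter> {x. (\<Sum>i<m. (x i)\<^sup>2) = 1}"
  have coord: "continuous_on UNIV (\<lambda>x::nat \<Rightarrow> real. x i)" for i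
    by simp
  have "compactin (product_topology (\<lambda>_. euclidean) UNIV) P"
    unfolding P_def compactin_PiE by auto
  then have "compact P"
    by (simp add: euclidean_product_topology)
  moreover have "closed {x::nat \<Rightarrow> real. (\<Sum>i<m. (x i)\<^sup>2) = 1}"
    by (intro closed_Collect_eq continuous_intros coord)
  ultimately have "compact S"
    unfolding S_def by (rule compact_Int_closed)
  moreover have "(\<lambda>i. if i = 0 then 1 else 0) \<in> S"
    using m by (auto simp: S_def P_def if_distrib[of "\<lambda>z. z\<^sup>2"] cong: if_cong)
  then have "S \<noteq> {}" by blast
  moreover have "continuous_on S q"
    unfolding q_def ip_def
    by (intro continuous_intros continuous_on_subset[OF coord] subset_UNIV)
  ultimately have "\<exists>x\<in>S. \<forall>y\<in>S. q x \<le> q y"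
    by (rule continuous_attains_inf)
  then obtain x where x: "x \<in> S" and min: "\<And>y. y \<in> S \<Longrightarrow> q x \<le> q y"
    by auto
  have "q x * (nrm m y)\<^sup>2 \<le> q y" for y
  proof (cases "nrm m y = 0")
    case True
    then have "\<forall>i<m. y i = 0" by (auto simp: L2_set_eq_0_iff)
    then show ?thesis using True by (simp add: q_def ip_def)
  next
    case False
    define c where "c = 1 / nrm m y"
    define z where "z i = (if i < m then c * y i else 0)" for i
    have nz: "nrm m z = 1"
      using False nrm_scale[where n = m and c = c and x = y]
      by (simp add: z_def c_def cong: L2_set_cong_simp)
    have "\<bar>z i\<bar> \<le> 1" if "i < m" for i using coord_le_nrm[OF that, of z] nz by simp
    then have "z \<in> P" by (force simp: P_def z_def abs_le_iff)
    moreover have "(\<Sum>i<m. (z i)\<^sup>2) = 1" using nz nrm_sq[of z m] by simp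
    ultimately have "z \<in> S" by (simp add: S_def)
    then have "q x \<le> q z" by (rule min)
    also have "q z = c\<^sup>2 * q y"
      by (simp add: q_def z_def ip_def power2_eq_square sum_distrib_left mult_ac)
    finally show ?thesis using False by (simp add: c_def field_simps)
  qed
  moreover have "nrm m x = 1" using x by (simp add: S_def L2_set_def)
  ultimately show ?thesis unfolding q_def by blast
qed

text \<open>A zero of a nonnegative quadratic form is a minimiser, so the gradient of the form vanishes
  there. The gradient is tested along itself.\<close>

lemma psd_null_vector:
  fixes g :: "nat \<Rightarrow> nat \<Rightarrow> real"
  assumes sym: "\<And>i j. i < m \<Longrightarrow> j < m \<Longrightarrow> g i j = g j i"
    and psd: "\<And>y. 0 \<le> ip m y (\<lambda>i. ip m (g i) y)"
    and null: "ip m x (\<lambda>i. ip m (g i) x) = 0"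
    and i: "i < m"
  shows "ip m (g i) x = 0"
proof -
  define z where "z i = ip m (g i) x" for i
  define a where "a = (nrm m z)\<^sup>2"
  define b where "b = ip m z (\<lambda>i. ip m (g i) z)"
  have cross: "ip m x (\<lambda>i. ip m (g i) z) = a"
  proof -
    have "ip m x (\<lambda>i. ip m (g i) z) = (\<Sum>i<m. \<Sum>j<m. x i * (g i j * z j))"
      by (simp add: ip_def sum_distrib_left)
    also have "\<dots> = (\<Sum>j<m. \<Sum>i<m. x i * (g i j * z j))" by (rule sum.swap)
    also have "\<dots> = (\<Sum>j<m. \<Sum>i<m. z j * (g j i * x i))"
      by (intro sum.cong refl) (simp add: sym)
    also have "\<dots> = ip m z z"
      by (simp add: ip_def z_def sum_distrib_left)
    finally show ?thesis by (simp add: a_def ip_self)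
  qed
  have quad: "0 \<le> 2 * t * a + t\<^sup>2 * b" for t
  proof -
    have "ip m (\<lambda>i. x i + t * z i) (\<lambda>i. ip m (g i) (\<lambda>i. x i + t * z i))
      = ip m x (\<lambda>i. ip m (g i) x) + t * ip m x (\<lambda>i. ip m (g i) z) + t * ip m z z + t\<^sup>2 * b"
      unfolding ip_add_right ip_scale_right b_def z_def[symmetric]
      by (simp add: ip_def algebra_simps sum.distrib sum_distrib_left power2_eq_square)
    then show ?thesis using psd[of "\<lambda>i. x i + t * z i"] null cross by (simp add: ip_self a_def)
  qed
  have "a = 0"
  proof (rule ccontr)
    assume "a \<noteq> 0"
    then have a: "a > 0" by (simp add: a_def)
    have b: "b \<ge> 0" unfolding b_def by (rule psd)
    \<comment> \<open>\<open>- a / b\<close> minimises the parabola; the shift by \<open>1\<close> covers \<open>b = 0\<close>.\<close>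
    define t where "t = - a / (b + 1)"
    have t: "t * (b + 1) = - a" using b by (simp add: t_def)
    have "0 \<le> (b + 1)\<^sup>2 * (2 * t * a + t\<^sup>2 * b)" using quad by simp
    also have "\<dots> = 2 * (t * (b + 1)) * a * (b + 1) + (t * (b + 1))\<^sup>2 * b"
      by (simp add: power2_eq_square algebra_simps)
    also have "\<dots> = - (a\<^sup>2 * (b + 2))"
      unfolding t by (simp add: power2_eq_square algebra_simps)
    finally have "a\<^sup>2 * (b + 2) \<le> 0" by simp
    moreover have "0 < a\<^sup>2 * (b + 2)" using a b by (intro mult_pos_pos) auto
    ultimately show False by linarith
  qed
  then show ?thesis using i by (auto simp: a_def L2_set_eq_0_iff z_def)
qed

lemma mult_mat_vec_ip:
  "M \<in> carrier_mat n m \<Longrightarrow> v \<in> carrier_vec m \<Longrightarrow> i < n \<Longrightarrow>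
    (M *\<^sub>v v) $ i = ip m (\<lambda>j. M $$ (i, j)) (($) v)"
  by (auto simp: scalar_prod_def ip_def atLeast0LessThan intro!: sum.cong)

lemma symmetric_eigenvalue_le_rayleigh:
  fixes G :: "real mat"
  assumes G: "G \<in> carrier_mat m m" and m: "0 < m"
    and sym: "\<And>i j. i < m \<Longrightarrow> j < m \<Longrightarrow> G $$ (i, j) = G $$ (j, i)"
  shows "\<exists>l. eigenvalue G l \<and>
    (\<forall>y. l * (nrm m y)\<^sup>2 \<le> ip m y (\<lambda>i. ip m (\<lambda>j. G $$ (i, j)) y))"
proof -
  obtain x l where x: "nrm m x = 1" and l: "ip m x (\<lambda>i. ip m (\<lambda>j. G $$ (i, j)) x) = l"
    and min: "\<And>y. l * (nrm m y)\<^sup>2 \<le> ip m y (\<lambda>i. ip m (\<lambda>j. G $$ (i, j)) y)"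
    using min_rayleigh_attained[OF m, of "\<lambda>i j. G $$ (i, j)"] by blast
  define g where "g i j = G $$ (i, j) - (if i = j then l else 0)" for i j
  have row: "ip m (g i) y = ip m (\<lambda>j. G $$ (i, j)) y - l * y i" if "i < m" for i y
  proof -
    have "ip m (g i) y = (\<Sum>j<m. G $$ (i, j) * y j - (if i = j then l * y j else 0))"
      by (auto simp: ip_def g_def algebra_simps intro!: sum.cong)
    then show ?thesis using that by (simp add: sum_subtractf ip_def)
  qed
  have form: "ip m y (\<lambda>i. ip m (g i) y)
      = ip m y (\<lambda>i. ip m (\<lambda>j. G $$ (i, j)) y) - l * (nrm m y)\<^sup>2" for y
  proof -
    have "ip m y (\<lambda>i. ip m (g i) y) = ip m y (\<lambda>i. ip m (\<lambda>j. G $$ (i, j)) y - l * y i)"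
      unfolding ip_def[of m y] by (simp add: row)
    then show ?thesis by (simp add: ip_diff_right ip_scale_right ip_self)
  qed
  have null: "ip m (g i) x = 0" if "i < m" for i
  proof (rule psd_null_vector[OF _ _ _ that])
    show "g i j = g j i" if "i < m" "j < m" for i j using that sym by (simp add: g_def)
  qed (use min form l x in auto)
  have "eigenvector G (vec m x) l"
  proof -
    have "vec m x \<noteq> 0\<^sub>v m"
    proof
      assume "vec m x = 0\<^sub>v m"
      then have "\<forall>i<m. x i = 0" by (metis index_vec index_zero_vec(1))
      then have "nrm m x = 0" by (simp add: L2_set_eq_0_iff)
      with x show False by simp
    qed
    moreover have "G *\<^sub>v vec m x = l \<cdot>\<^sub>v vec m x"
    proof (rule eq_vecI)
      fix i assume "i < dim_vec (l \<cdot>\<^sub>v vec m x)"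
      then have i: "i < m" by simp
      have "(G *\<^sub>v vec m x) $ i = ip m (\<lambda>j. G $$ (i, j)) x"
        using mult_mat_vec_ip[OF G, of "vec m x" i] i by (simp add: ip_def)
      then show "(G *\<^sub>v vec m x) $ i = (l \<cdot>\<^sub>v vec m x) $ i"
        using null[OF i] row[OF i, of x] i by simp
    qed (use G in simp)
    ultimately show ?thesis using G by (simp add: eigenvector_def)
  qed
  then show ?thesis using min unfolding eigenvalue_def by blast
qed


section \<open>Rounding errors of the elementary operations\<close>

lemma abs_sum_mset_le: "\<bar>sum_mset M\<bar> \<le> (\<Sum>x\<in>#M. \<bar>x\<bar>)" for M :: "real multiset"
  by (induction M) auto

text \<open>Each addition at most doubles the relative error inherited from its summands and adds one
  further \<open>\<epsilon>\<close>. The depth of the summation tree is less than the number of summands, whatever the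
  order, so an exponential constant covers all orders at once.\<close>

lemma fl_sum_error:
  assumes "fl_sum \<epsilon> M s" and "0 \<le> \<epsilon>" "\<epsilon> \<le> 1"
  shows "1 \<le> size M \<and> \<bar>s - sum_mset M\<bar> \<le> (2 ^ size M - 1) * \<epsilon> * (\<Sum>x\<in>#M. \<bar>x\<bar>)"
  using assms(1)
proof induction
  case (single x)
  then show ?case using assms by simp
next
  case (add M x N y z)
  define X where "X = (\<Sum>x\<in>#M. \<bar>x\<bar>)"
  define Y where "Y = (\<Sum>x\<in>#N. \<bar>x\<bar>)"
  define h :: real where "h = 2 ^ (size M + size N) / 2"
  have XY: "0 \<le> X" "0 \<le> Y" "\<bar>sum_mset M\<bar> \<le> X" "\<bar>sum_mset N\<bar> \<le> Y"
    using abs_sum_mset_le[of M] abs_sum_mset_le[of N] unfolding X_def Y_def by linarith+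
  obtain \<delta> where d: "\<bar>\<delta>\<bar> \<le> \<epsilon>" and z: "z = (x + y) * (1 + \<delta>)"
    using add.hyps by (auto simp: fl_rounds_def)
  have pow: "2 ^ a \<le> h" if "a + 1 \<le> size M + size N" for a
  proof -
    have "(2::real) ^ (a + 1) \<le> 2 ^ (size M + size N)" using that by (rule power_increasing) simp
    then show ?thesis by (simp add: h_def)
  qed
  have "2 ^ size M \<le> h" "2 ^ size N \<le> h"
    using add.IH by (auto intro!: pow)
  then have "(2 ^ size M - 1) * (\<epsilon> * X) \<le> (h - 1) * (\<epsilon> * X)"
    "(2 ^ size N - 1) * (\<epsilon> * Y) \<le> (h - 1) * (\<epsilon> * Y)"
    using XY assms by (auto intro!: mult_right_mono)
  moreover have "\<bar>x - sum_mset M\<bar> \<le> (2 ^ size M - 1) * (\<epsilon> * X)"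
    using add.IH(1) by (simp only: X_def mult.assoc)
  moreover have "\<bar>y - sum_mset N\<bar> \<le> (2 ^ size N - 1) * (\<epsilon> * Y)"
    using add.IH(2) by (simp only: Y_def mult.assoc)
  ultimately have ex: "\<bar>x - sum_mset M\<bar> \<le> (h - 1) * (\<epsilon> * X)"
    and ey: "\<bar>y - sum_mset N\<bar> \<le> (h - 1) * (\<epsilon> * Y)"
    by linarith+
  define e where "e = (h - 1) * (\<epsilon> * (X + Y))"
  have e: "\<bar>(x + y) - (sum_mset M + sum_mset N)\<bar> \<le> e"
    using ex ey unfolding e_def ring_distribs by linarith
  have "\<bar>(x + y) * \<delta>\<bar> \<le> (X + Y + e) * \<epsilon>"
    unfolding abs_mult using e XY d by (intro mult_mono) auto
  moreover have "e * \<epsilon> \<le> e"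
    using e assms mult_left_mono[of \<epsilon> 1 e] by auto
  ultimately have "\<bar>z - (sum_mset M + sum_mset N)\<bar> \<le> 2 * e + (X + Y) * \<epsilon>"
    using e unfolding z by (simp add: algebra_simps)
  also have "\<dots> = (2 * h - 1) * \<epsilon> * (X + Y)"
    unfolding e_def by (simp add: algebra_simps)
  finally show ?case using add.IH by (simp add: h_def X_def Y_def)
qed

text \<open>The constant of the projection step dominates the other two, so that a single smallness
  condition \<open>step_const n * \<epsilon> \<le> 1 / 2\<close> serves for all estimates.\<close>

definition dot_const :: "nat \<Rightarrow> real" where "dot_const n = 2 ^ (n + 2)"
definition normalize_const :: "nat \<Rightarrow> real" where "normalize_const n = 2 * (dot_const n + 3)"
definition step_const :: "nat \<Rightarrow> real" where
  "step_const n = 19 + 4 * normalize_const n + 2 * dot_const n"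

lemma const_pos: "0 < dot_const n" "0 < normalize_const n" "0 < step_const n"
proof -
  show d: "0 < dot_const n" by (simp add: dot_const_def)
  then show "0 < normalize_const n" by (simp add: normalize_const_def)
  with d show "0 < step_const n" by (simp add: step_const_def)
qed

lemma const_small:
  assumes "0 \<le> \<epsilon>" "step_const n * \<epsilon> \<le> 1 / 2"
  shows "dot_const n * \<epsilon> \<le> 1 / 2" "normalize_const n * \<epsilon> \<le> 1 / 2" "\<epsilon> \<le> 1 / 2"
proof -
  have le: "dot_const n \<le> step_const n" "normalize_const n \<le> step_const n" "1 \<le> step_const n"
    using const_pos[of n] by (auto simp: step_const_def)
  show "dot_const n * \<epsilon> \<le> 1 / 2" "normalize_const n * \<epsilon> \<le> 1 / 2" "\<epsilon> \<le> 1 / 2"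
    using le[THEN mult_right_mono, OF assms(1)] assms(2) by auto
qed

lemma fl_dot_error:
  assumes "fl_dot \<epsilon> x y s" and n: "dim_vec x = n" and eps: "0 \<le> \<epsilon>" "\<epsilon> \<le> 1"
  shows "\<bar>s - ip n (($) x) (($) y)\<bar> \<le> dot_const n * \<epsilon> * (\<Sum>i<n. \<bar>x $ i * y $ i\<bar>)"
proof -
  obtain t where t: "\<forall>i<n. fl_rounds \<epsilon> (x $ i * y $ i) (t i)"
    and s: "fl_sum \<epsilon> (image_mset t (mset_set {..<n})) s"
    using assms by (auto simp: fl_dot_def)
  define S where "S = (\<Sum>i<n. \<bar>x $ i * y $ i\<bar>)"
  have S0: "0 \<le> S" by (simp add: S_def sum_nonneg)
  have ti: "\<bar>t i - x $ i * y $ i\<bar> \<le> \<epsilon> * \<bar>x $ i * y $ i\<bar>" if "i < n" for i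
  proof -
    obtain \<delta> where "\<bar>\<delta>\<bar> \<le> \<epsilon>" "t i = x $ i * y $ i * (1 + \<delta>)"
      using t \<open>i < n\<close> by (auto simp: fl_rounds_def)
    then have "\<bar>t i - x $ i * y $ i\<bar> = \<bar>\<delta>\<bar> * \<bar>x $ i * y $ i\<bar>"
      by (simp add: algebra_simps abs_mult)
    then show ?thesis using \<open>\<bar>\<delta>\<bar> \<le> \<epsilon>\<close> by (simp add: mult_right_mono)
  qed
  have "\<bar>(\<Sum>i<n. t i) - ip n (($) x) (($) y)\<bar> \<le> (\<Sum>i<n. \<bar>t i - x $ i * y $ i\<bar>)"
    unfolding ip_def sum_subtractf[symmetric] by (rule sum_abs)
  also have "\<dots> \<le> (\<Sum>i<n. \<epsilon> * \<bar>x $ i * y $ i\<bar>)"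
    by (rule sum_mono) (simp add: ti)
  finally have e1: "\<bar>(\<Sum>i<n. t i) - ip n (($) x) (($) y)\<bar> \<le> \<epsilon> * S"
    by (simp add: S_def sum_distrib_left)
  have "(\<Sum>i<n. \<bar>t i\<bar>) \<le> (\<Sum>i<n. 2 * \<bar>x $ i * y $ i\<bar>)"
  proof (rule sum_mono)
    fix i assume "i \<in> {..<n}"
    then have "\<bar>t i - x $ i * y $ i\<bar> \<le> 1 * \<bar>x $ i * y $ i\<bar>"
      using ti[of i] mult_right_mono[OF eps(2), of "\<bar>x $ i * y $ i\<bar>"] by simp
    then show "\<bar>t i\<bar> \<le> 2 * \<bar>x $ i * y $ i\<bar>" by linarith
  qed
  then have T: "(\<Sum>i<n. \<bar>t i\<bar>) \<le> 2 * S" by (simp add: S_def sum_distrib_left)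
  have "\<bar>s - (\<Sum>i<n. t i)\<bar> \<le> (2 ^ n - 1) * \<epsilon> * (\<Sum>i<n. \<bar>t i\<bar>)"
    using fl_sum_error[OF s eps]
    by (simp add: sum_unfold_sum_mset image_mset.compositionality comp_def)
  also have "\<dots> \<le> (2 ^ n - 1) * \<epsilon> * (2 * S)"
    using T eps by (intro mult_left_mono) auto
  finally have "\<bar>s - ip n (($) x) (($) y)\<bar> \<le> (2 * 2 ^ n - 1) * (\<epsilon> * S)"
    using e1 by (simp add: algebra_simps)
  also have "\<dots> \<le> dot_const n * (\<epsilon> * S)"
  proof (rule mult_right_mono)
    have "0 < (2::real) ^ n" by simp
    moreover have "dot_const n = 4 * 2 ^ n" by (simp add: dot_const_def)
    ultimately show "2 * 2 ^ n - 1 \<le> dot_const n" by linarith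
  qed (use S0 eps in simp)
  finally show ?thesis by (simp add: S_def mult.assoc)
qed

text \<open>A sum of squares is free of cancellation, so the computed norm has a small relative error.\<close>

lemma fl_norm2_error:
  assumes r: "fl_norm2 \<epsilon> u r" and n: "dim_vec u = n"
    and eps: "0 \<le> \<epsilon>" and small: "step_const n * \<epsilon> \<le> 1 / 2"
  shows "\<bar>r - nrm n (($) u)\<bar> \<le> (dot_const n + 2) * \<epsilon> * nrm n (($) u)"
proof -
  note sm = const_small[OF eps small]
  define \<nu> where "\<nu> = nrm n (($) u)"
  obtain s \<delta> where s: "fl_dot \<epsilon> u u s" and d: "\<bar>\<delta>\<bar> \<le> \<epsilon>" and r: "r = sqrt s * (1 + \<delta>)"
    using r by (auto simp: fl_norm2_def fl_rounds_def)
  have "(\<Sum>i<n. \<bar>u $ i * u $ i\<bar>) = \<nu>\<^sup>2"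
    unfolding \<nu>_def nrm_sq by (simp add: power2_eq_square)
  moreover have "\<epsilon> \<le> 1" using sm by simp
  ultimately have err: "\<bar>s - \<nu>\<^sup>2\<bar> \<le> dot_const n * \<epsilon> * \<nu>\<^sup>2"
    using fl_dot_error[OF s n eps] by (simp add: ip_self \<nu>_def)
  have "dot_const n * \<epsilon> * \<nu>\<^sup>2 \<le> 1 / 2 * \<nu>\<^sup>2"
    using sm by (intro mult_right_mono) auto
  with err have s0: "0 \<le> s" using zero_le_power2[of \<nu>] by linarith
  have \<nu>0: "0 \<le> \<nu>" by (simp add: \<nu>_def)
  have root: "\<bar>sqrt s - \<nu>\<bar> \<le> dot_const n * \<epsilon> * \<nu>"
  proof (cases "\<nu> = 0")
    case True
    then show ?thesis using err by simp
  next
    case False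
    have "\<nu> * \<bar>sqrt s - \<nu>\<bar> \<le> (sqrt s + \<nu>) * \<bar>sqrt s - \<nu>\<bar>"
      using s0 by (intro mult_right_mono) auto
    also have "\<dots> = \<bar>s - \<nu>\<^sup>2\<bar>"
    proof -
      have "(sqrt s + \<nu>) * (sqrt s - \<nu>) = s - \<nu>\<^sup>2"
        using s0 by (simp add: algebra_simps power2_eq_square)
      moreover have "\<bar>sqrt s + \<nu>\<bar> = sqrt s + \<nu>" using s0 \<nu>0 by simp
      ultimately show ?thesis by (metis abs_mult)
    qed
    also note err
    finally have "\<nu> * \<bar>sqrt s - \<nu>\<bar> \<le> \<nu> * (dot_const n * \<epsilon> * \<nu>)"
      by (simp add: power2_eq_square mult_ac)
    then show ?thesis using False \<nu>0 by simp
  qed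
  have "\<bar>sqrt s\<bar> \<le> 2 * \<nu>"
    using root mult_right_mono[OF sm(1) \<nu>0] \<nu>0 by linarith
  then have "\<bar>sqrt s * \<delta>\<bar> \<le> 2 * \<nu> * \<epsilon>"
    unfolding abs_mult using d \<nu>0 by (intro mult_mono) auto
  with root have "\<bar>r - \<nu>\<bar> \<le> dot_const n * \<epsilon> * \<nu> + 2 * \<nu> * \<epsilon>"
    unfolding r by (simp add: algebra_simps)
  then show ?thesis by (simp add: \<nu>_def algebra_simps)
qed

lemma fl_normalize_error:
  assumes v: "fl_normalize \<epsilon> u v" and n: "dim_vec u = n"
    and eps: "0 \<le> \<epsilon>" and small: "step_const n * \<epsilon> \<le> 1 / 2"
  shows "0 < nrm n (($) u)"
    and "nrm n (\<lambda>i. v $ i - u $ i / nrm n (($) u)) \<le> normalize_const n * \<epsilon>"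
proof -
  note sm = const_small[OF eps small]
  define \<nu> where "\<nu> = nrm n (($) u)"
  obtain r where r: "fl_norm2 \<epsilon> u r" and r0: "r \<noteq> 0"
    and vi: "\<And>i. i < n \<Longrightarrow> fl_rounds \<epsilon> (u $ i / r) (v $ i)"
    using v n by (auto simp: fl_normalize_def)
  define e where "e = (dot_const n + 2) * \<epsilon>"
  have re: "\<bar>r - \<nu>\<bar> \<le> e * \<nu>"
    using fl_norm2_error[OF r n eps small] by (simp add: \<nu>_def e_def)
  have e: "e \<le> 1 / 2" "0 \<le> e"
    using sm(2) eps const_pos[of n] by (auto simp: e_def normalize_const_def algebra_simps)
  have \<nu>0: "0 \<le> \<nu>" by (simp add: \<nu>_def)
  have "\<nu> \<noteq> 0" using re r0 by auto
  then have pos: "0 < \<nu>" using \<nu>0 by simp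
  then show "0 < nrm n (($) u)" by (simp add: \<nu>_def)
  have "e * \<nu> \<le> 1 / 2 * \<nu>" using e \<nu>0 by (intro mult_right_mono) auto
  with re have r_ge: "\<nu> / 2 \<le> r" by linarith
  have comp: "\<bar>v $ i - u $ i / \<nu>\<bar> \<le> \<bar>normalize_const n * \<epsilon> * (u $ i / \<nu>)\<bar>" if i: "i < n" for i
  proof -
    obtain \<delta> where d: "\<bar>\<delta>\<bar> \<le> \<epsilon>" and vd: "v $ i = u $ i / r * (1 + \<delta>)"
      using vi[OF i] by (auto simp: fl_rounds_def)
    define f where "f = (\<nu> - r + \<nu> * \<delta>) / r"
    have "v $ i - u $ i / \<nu> = f * (u $ i / \<nu>)"
      unfolding vd f_def using pos r0 by (simp add: field_simps)
    moreover have "\<bar>f\<bar> \<le> normalize_const n * \<epsilon>"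
    proof -
      have "\<bar>\<nu> * \<delta>\<bar> \<le> \<nu> * \<epsilon>" unfolding abs_mult using d pos by (intro mult_mono) auto
      then have "\<bar>\<nu> - r + \<nu> * \<delta>\<bar> \<le> (e + \<epsilon>) * \<nu>"
        using re by (simp add: algebra_simps)
      also have "\<dots> \<le> (e + \<epsilon>) * (2 * r)"
        using r_ge e eps by (intro mult_left_mono) auto
      also have "\<dots> = normalize_const n * \<epsilon> * r"
        by (simp add: e_def normalize_const_def algebra_simps)
      finally show ?thesis using r_ge pos by (simp add: f_def divide_le_eq abs_divide)
    qed
    ultimately show ?thesis
      using eps const_pos[of n] mult_right_mono[of "\<bar>f\<bar>" _ "\<bar>u $ i / \<nu>\<bar>"]
      by (simp only: abs_mult)
  qed
  have "nrm n (\<lambda>i. v $ i - u $ i / \<nu>) \<le> nrm n (\<lambda>i. normalize_const n * \<epsilon> * (u $ i / \<nu>))"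
    by (rule nrm_mono) (rule comp)
  also have "\<dots> = normalize_const n * \<epsilon> * nrm n (\<lambda>i. u $ i / \<nu>)"
    using const_pos[of n] eps by (simp only: nrm_scale) simp
  also have "nrm n (\<lambda>i. u $ i / \<nu>) = 1"
    using nrm_scale[where n = n and c = "1 / \<nu>" and x = "($) u"] pos by (simp add: \<nu>_def)
  finally show "nrm n (\<lambda>i. v $ i - u $ i / nrm n (($) u)) \<le> normalize_const n * \<epsilon>"
    by (simp add: \<nu>_def)
qed

text \<open>The coordinates of \<^term>\<open>unit_vec_of v\<close>.\<close>

definition dir :: "nat \<Rightarrow> real vec \<Rightarrow> nat \<Rightarrow> real" where
  "dir n v i = v $ i / nrm n (($) v)"

lemma nrm_dir: "0 < nrm n (($) v) \<Longrightarrow> nrm n (dir n v) = 1"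
  using nrm_scale[where n = n and c = "1 / nrm n (($) v)" and x = "($) v"]
  by (simp add: dir_def[abs_def])

text \<open>Exact normalisation moves \<open>v\<close> by \<open>\<bar>\<parallel>v\<parallel> - 1\<bar>\<close>, which is at most its distance to any unit
  vector \<open>x\<close>.\<close>

lemma dir_near:
  assumes x: "nrm n x = 1" and vx: "nrm n (\<lambda>i. v $ i - x i) \<le> \<eta>" and \<eta>: "\<eta> \<le> 1 / 2"
  shows "nrm n (dir n v) = 1" "nrm n (\<lambda>i. v $ i - dir n v i) \<le> \<eta>"
    "nrm n (\<lambda>i. x i - dir n v i) \<le> 2 * \<eta>"
proof -
  define \<nu> where "\<nu> = nrm n (($) v)"
  have d: "\<bar>\<nu> - 1\<bar> \<le> \<eta>"
    using nrm_le_dist[of "($) v" n x] nrm_le_dist[of x n "($) v"]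
      nrm_minus_commute[of "($) v" x n] vx x by (simp add: \<nu>_def)
  then have pos: "0 < \<nu>" using \<eta> by linarith
  show "nrm n (dir n v) = 1" using pos by (simp add: \<nu>_def nrm_dir)
  have "nrm n (\<lambda>i. v $ i - dir n v i) = nrm n (\<lambda>i. (1 - 1 / \<nu>) * v $ i)"
    by (rule L2_set_cong) (auto simp: dir_def \<nu>_def algebra_simps)
  also have "\<dots> = \<bar>1 - 1 / \<nu>\<bar> * \<nu>" by (simp only: nrm_scale \<nu>_def)
  also have "\<dots> = \<bar>(1 - 1 / \<nu>) * \<nu>\<bar>" using pos by (simp add: abs_mult)
  also have "\<dots> = \<bar>\<nu> - 1\<bar>" using pos by (simp add: left_diff_distrib)
  finally show vd: "nrm n (\<lambda>i. v $ i - dir n v i) \<le> \<eta>" using d by simp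
  show "nrm n (\<lambda>i. x i - dir n v i) \<le> 2 * \<eta>"
    using nrm_dist_triangle[of x "dir n v" n "($) v"] vd vx
      nrm_minus_commute[of "($) v" x n] by simp
qed

text \<open>Replacing the computed \<open>v\<close> by its exact direction \<open>q\<close> costs only another error of order
  \<open>\<epsilon> \<parallel>w\<parallel>\<close>, and makes the step a perturbed orthogonal projection.\<close>

lemma mgs_step_error:
  assumes h: "fl_dot \<epsilon> v w h" and w': "fl_sub_smult \<epsilon> w h v w'"
    and n: "dim_vec v = n" "dim_vec w = n"
    and q: "nrm n q = 1" and vq: "nrm n (\<lambda>i. v $ i - q i) \<le> normalize_const n * \<epsilon>"
    and eps: "0 \<le> \<epsilon>" and small: "step_const n * \<epsilon> \<le> 1 / 2"
  shows "nrm n (\<lambda>i. w' $ i - (w $ i - ip n q (($) w) * q i)) \<le> step_const n * \<epsilon> * nrm n (($) w)"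
    and "nrm n (($) w') \<le> 3 * nrm n (($) w)"
proof -
  note sm = const_small[OF eps small]
  define \<omega> where "\<omega> = nrm n (($) w)"
  define h0 where "h0 = ip n q (($) w)"
  define \<eta> where "\<eta> = normalize_const n * \<epsilon>"
  define \<kappa> where "\<kappa> = dot_const n * \<epsilon>"
  have \<omega>0: "0 \<le> \<omega>" by (simp add: \<omega>_def)
  have \<kappa>0: "0 \<le> \<kappa>" "\<kappa> \<le> 1 / 2" using const_pos[of n] eps sm by (auto simp: \<kappa>_def)
  have \<eta>0: "0 \<le> \<eta>" "\<eta> \<le> 1 / 2" using const_pos[of n] eps sm by (auto simp: \<eta>_def)
  have v2: "nrm n (($) v) \<le> 2"
    using nrm_le_dist[of "($) v" n q] vq q \<eta>0 by (simp add: \<eta>_def)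
  have vw: "\<bar>ip n (($) v) (($) w) - h0\<bar> \<le> \<eta> * \<omega>"
  proof -
    have "\<bar>ip n (($) v) (($) w) - h0\<bar> \<le> nrm n (\<lambda>i. v $ i - q i) * \<omega>"
      unfolding h0_def \<omega>_def ip_diff_left[symmetric] by (rule ip_bound)
    also have "\<dots> \<le> \<eta> * \<omega>" using vq \<omega>0 by (intro mult_right_mono) (auto simp: \<eta>_def)
    finally show ?thesis .
  qed
  have hv: "\<bar>h - ip n (($) v) (($) w)\<bar> \<le> 2 * \<kappa> * \<omega>"
  proof -
    have "(\<Sum>i<n. \<bar>v $ i * w $ i\<bar>) \<le> nrm n (($) v) * \<omega>"
      unfolding \<omega>_def abs_mult by (rule L2_set_mult_ineq)
    also have "\<dots> \<le> 2 * \<omega>" using v2 \<omega>0 by (rule mult_right_mono)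
    finally have "\<kappa> * (\<Sum>i<n. \<bar>v $ i * w $ i\<bar>) \<le> \<kappa> * (2 * \<omega>)"
      using \<kappa>0 by (intro mult_left_mono) auto
    then show ?thesis using fl_dot_error[OF h n(1) eps] sm by (simp add: \<kappa>_def)
  qed
  have h0w: "\<bar>h0\<bar> \<le> \<omega>"
    using ip_bound[of n q "($) w"] q by (simp add: h0_def \<omega>_def)
  have hh0: "\<bar>h - h0\<bar> \<le> (2 * \<kappa> + \<eta>) * \<omega>"
    using vw hv by (simp add: algebra_simps)
  also have "\<dots> \<le> 2 * \<omega>" using \<kappa>0 \<eta>0 \<omega>0 by (intro mult_right_mono) auto
  finally have h3: "\<bar>h\<bar> \<le> 3 * \<omega>" using h0w by linarith
  define g where "g i = w' $ i - (w $ i - h * v $ i)" for i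
  have g: "\<bar>g i\<bar> \<le> \<bar>\<epsilon> * \<bar>w $ i\<bar> + 3 * \<epsilon> * \<bar>h\<bar> * \<bar>v $ i\<bar>\<bar>" if i: "i < n" for i
  proof -
    obtain t where t: "fl_rounds \<epsilon> (h * v $ i) t" "fl_rounds \<epsilon> (w $ i - t) (w' $ i)"
      using w' i n by (auto simp: fl_sub_smult_def)
    then obtain a b where a: "\<bar>a\<bar> \<le> \<epsilon>" and b: "\<bar>b\<bar> \<le> \<epsilon>"
      and wi: "w' $ i = (w $ i - h * v $ i * (1 + a)) * (1 + b)"
      by (auto simp: fl_rounds_def)
    define p where "p = h * v $ i"
    have g_eq: "g i = w $ i * b - p * a - p * b * (1 + a)"
      unfolding g_def wi p_def by (simp add: algebra_simps)
    have t1: "\<bar>w $ i * b\<bar> \<le> \<epsilon> * \<bar>w $ i\<bar>" "\<bar>p * a\<bar> \<le> \<epsilon> * \<bar>p\<bar>"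
      using a b by (simp_all add: abs_mult mult.commute mult_right_mono)
    have t2: "\<bar>p * b * (1 + a)\<bar> \<le> \<bar>p\<bar> * \<epsilon> * 2"
      unfolding abs_mult using a b sm by (intro mult_mono) auto
    have "\<bar>g i\<bar> \<le> \<bar>w $ i * b\<bar> + \<bar>p * a\<bar> + \<bar>p * b * (1 + a)\<bar>"
      unfolding g_eq by (intro order_trans[OF abs_triangle_ineq4] add_right_mono abs_triangle_ineq4)
    also have "\<dots> \<le> \<epsilon> * \<bar>w $ i\<bar> + \<epsilon> * \<bar>p\<bar> + \<bar>p\<bar> * \<epsilon> * 2"
      by (intro add_mono t1 t2)
    finally have "\<bar>g i\<bar> \<le> \<epsilon> * \<bar>w $ i\<bar> + 3 * \<epsilon> * \<bar>p\<bar>" by simp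
    then show ?thesis by (simp add: p_def abs_mult mult_ac)
  qed
  have "nrm n g \<le> nrm n (\<lambda>i. \<epsilon> * \<bar>w $ i\<bar> + 3 * \<epsilon> * \<bar>h\<bar> * \<bar>v $ i\<bar>)"
    by (rule nrm_mono) (rule g)
  also have "\<dots> \<le> nrm n (\<lambda>i. \<epsilon> * \<bar>w $ i\<bar>) + nrm n (\<lambda>i. 3 * \<epsilon> * \<bar>h\<bar> * \<bar>v $ i\<bar>)"
    by (rule nrm_triangle)
  also have "\<dots> = \<epsilon> * \<omega> + 3 * \<epsilon> * \<bar>h\<bar> * nrm n (($) v)"
    using eps by (simp add: nrm_scale nrm_abs \<omega>_def abs_mult)
  also have "\<dots> \<le> \<epsilon> * \<omega> + 3 * \<epsilon> * (3 * \<omega>) * 2"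
    using h3 v2 eps \<omega>0 by (intro add_left_mono mult_mono mult_left_mono) auto
  finally have gn: "nrm n g \<le> 19 * \<epsilon> * \<omega>" by simp
  have "nrm n (\<lambda>i. (h * (q i - v $ i)) + ((h0 - h) * q i))
      \<le> nrm n (\<lambda>i. h * (q i - v $ i)) + nrm n (\<lambda>i. (h0 - h) * q i)"
    by (rule nrm_triangle)
  also have "\<dots> = \<bar>h\<bar> * nrm n (\<lambda>i. v $ i - q i) + \<bar>h - h0\<bar>"
    using nrm_minus_commute[of q "($) v" n] by (simp only: nrm_scale q) simp
  also have "\<dots> \<le> 3 * \<omega> * \<eta> + (2 * \<kappa> + \<eta>) * \<omega>"
    using h3 vq hh0 \<omega>0 by (intro add_mono mult_mono) (auto simp: \<eta>_def)
  finally have pn: "nrm n (\<lambda>i. (h * (q i - v $ i)) + ((h0 - h) * q i))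
      \<le> (4 * \<eta> + 2 * \<kappa>) * \<omega>" by (simp add: algebra_simps)
  have "nrm n (\<lambda>i. w' $ i - (w $ i - h0 * q i))
      = nrm n (\<lambda>i. g i + ((h * (q i - v $ i)) + ((h0 - h) * q i)))"
    by (rule L2_set_cong) (auto simp: g_def algebra_simps)
  also have "\<dots> \<le> 19 * \<epsilon> * \<omega> + (4 * \<eta> + 2 * \<kappa>) * \<omega>"
    by (rule order_trans[OF nrm_triangle add_mono[OF gn pn]])
  also have "\<dots> = step_const n * \<epsilon> * \<omega>"
    by (simp add: \<eta>_def \<kappa>_def step_const_def algebra_simps)
  finally have main: "nrm n (\<lambda>i. w' $ i - (w $ i - h0 * q i)) \<le> step_const n * \<epsilon> * \<omega>" .
  then show "nrm n (\<lambda>i. w' $ i - (w $ i - ip n q (($) w) * q i))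
      \<le> step_const n * \<epsilon> * nrm n (($) w)"
    by (simp add: h0_def \<omega>_def)
  have "nrm n (\<lambda>i. w $ i - h0 * q i) \<le> \<omega> + \<bar>h0\<bar>"
    using nrm_triangle_diff[of "($) w" "\<lambda>i. h0 * q i" n] q by (simp add: nrm_scale \<omega>_def)
  moreover have "step_const n * \<epsilon> * \<omega> \<le> 1 / 2 * \<omega>"
    using small \<omega>0 by (rule mult_right_mono)
  ultimately have "nrm n (($) w') \<le> 3 * \<omega>"
    using nrm_le_dist[of "($) w'" n "\<lambda>i. w $ i - h0 * q i"] main h0w \<omega>0 by linarith
  then show "nrm n (($) w') \<le> 3 * nrm n (($) w)" by (simp add: \<omega>_def)
qed


section \<open>Columns of the computed factorization\<close>

definition nearly_unit :: "real \<Rightarrow> nat \<Rightarrow> real vec \<Rightarrow> bool" where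
  "nearly_unit \<epsilon> n v \<longleftrightarrow> dim_vec v = n \<and> nrm n (dir n v) = 1 \<and>
     nrm n (\<lambda>i. v $ i - dir n v i) \<le> normalize_const n * \<epsilon>"

lemma fl_mgs_dim: "fl_mgs \<epsilon> V w u \<Longrightarrow> dim_vec u = dim_vec w"
  by (induction rule: fl_mgs.induct) (auto simp: fl_sub_smult_def)

text \<open>
  The projection along \<open>q\<^sub>i\<close> leaves a vector orthogonal to \<open>q\<^sub>i\<close> up to rounding. Only the later
  subtractions of \<open>r\<^sub>l q\<^sub>l\<close>, \<open>l > i\<close>, change the component along \<open>q\<^sub>i\<close> again, so the final vector
  \<open>u\<close> together with these subtracted terms has almost no component along \<open>q\<^sub>i\<close>. This is the second
  estimate below; the first says that nothing but the subtracted terms is lost from \<open>w\<close>.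
  The powers of \<open>3\<close> and \<open>4\<close> come from the crude bound by \<open>3\<close> for the growth in one step.
\<close>

lemma fl_mgs_error:
  assumes "fl_mgs \<epsilon> V w u" and "dim_vec w = n" and "\<forall>v\<in>set V. nearly_unit \<epsilon> n v"
    and eps: "0 \<le> \<epsilon>" and small: "step_const n * \<epsilon> \<le> 1 / 2"
  shows "nrm n (($) u) \<le> 3 ^ length V * nrm n (($) w) \<and>
    (\<exists>r. nrm n (\<lambda>i. w $ i - (\<Sum>l<length V. r l * dir n (V ! l) i) - u $ i)
           \<le> step_const n * 4 ^ length V * \<epsilon> * nrm n (($) w) \<and>
      (\<forall>i<length V. \<bar>ip n (dir n (V ! i)) (($) u)
             + (\<Sum>l<length V. if i < l then r l * ip n (dir n (V ! i)) (dir n (V ! l)) else 0)\<bar>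
           \<le> step_const n * 4 ^ length V * \<epsilon> * nrm n (($) w)))"
  using assms(1-3)
proof (induction rule: fl_mgs.induct)
  case (Nil w)
  have "nrm n (\<lambda>i. 0) = 0" by (simp add: L2_set_def)
  then show ?case using const_pos[of n] eps by simp
next
  case (Cons v w h w' V u)
  define q where "q l = dir n (V ! l)" for l
  define c where "c = dir n v"
  define k where "k = length V"
  define \<omega> where "\<omega> = nrm n (($) w)"
  define \<omega>' where "\<omega>' = nrm n (($) w')"
  define s where "s = step_const n * \<epsilon>"
  have s0: "0 \<le> s" using const_pos[of n] eps by (simp add: s_def)
  have \<omega>0: "0 \<le> \<omega>" by (simp add: \<omega>_def)
  have v: "dim_vec v = n" "nrm n c = 1" "nrm n (\<lambda>i. v $ i - c i) \<le> normalize_const n * \<epsilon>"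
    using Cons.prems by (auto simp: nearly_unit_def c_def)
  define h0 where "h0 = ip n c (($) w)"
  define f where "f i = w' $ i - (w $ i - h0 * c i)" for i
  have f: "nrm n f \<le> s * \<omega>" and w'3: "\<omega>' \<le> 3 * \<omega>"
    using mgs_step_error[OF Cons.hyps(1,2) v(1) Cons.prems(1) v(2,3) eps small]
    by (auto simp: f_def[abs_def] s_def \<omega>_def \<omega>'_def h0_def)
  have w': "dim_vec w' = n" using Cons.hyps(2) Cons.prems(1) by (auto simp: fl_sub_smult_def)
  have V: "\<forall>v\<in>set V. nearly_unit \<epsilon> n v" using Cons.prems(2) by simp
  have se: "step_const n * 4 ^ k * \<epsilon> * \<omega>' = s * 4 ^ k * \<omega>'" by (simp add: s_def)
  have IH: "nrm n (($) u) \<le> 3 ^ k * \<omega>' \<and>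
    (\<exists>r. nrm n (\<lambda>i. w' $ i - (\<Sum>l<k. r l * q l i) - u $ i) \<le> s * 4 ^ k * \<omega>' \<and>
      (\<forall>i<k. \<bar>ip n (q i) (($) u) + (\<Sum>l<k. if i < l then r l * ip n (q i) (q l) else 0)\<bar>
           \<le> s * 4 ^ k * \<omega>'))"
    using Cons.IH[OF w' V] unfolding k_def[symmetric] \<omega>'_def[symmetric] se q_def .
  from IH obtain r where u: "nrm n (($) u) \<le> 3 ^ k * \<omega>'"
    and r1: "nrm n (\<lambda>i. w' $ i - (\<Sum>l<k. r l * q l i) - u $ i) \<le> s * 4 ^ k * \<omega>'"
    and r2: "\<And>i. i < k \<Longrightarrow> \<bar>ip n (q i) (($) u) + (\<Sum>l<k. if i < l then r l * ip n (q i) (q l) else 0)\<bar>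
           \<le> s * 4 ^ k * \<omega>'"
    by blast
  define r' where "r' l = (case l of 0 \<Rightarrow> h0 | Suc l \<Rightarrow> r l)" for l
  define g where "g i = w' $ i - (\<Sum>l<k. r l * q l i) - u $ i" for i
  have "s * 4 ^ k * \<omega>' \<le> s * 4 ^ k * (3 * \<omega>)" using w'3 s0 by (intro mult_left_mono) auto
  moreover have "s * 1 * \<omega> \<le> s * 4 ^ k * \<omega>"
    using s0 \<omega>0 by (intro mult_right_mono mult_left_mono) auto
  ultimately have e3: "s * 4 ^ k * \<omega>' + s * \<omega> \<le> s * 4 ^ Suc k * \<omega>" by simp
  have e4: "s * 4 ^ k * \<omega>' \<le> s * 4 ^ Suc k * \<omega>"
    using e3 mult_nonneg_nonneg[OF s0 \<omega>0] by linarith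
  have g: "nrm n g \<le> s * 4 ^ k * \<omega>'" using r1 by (simp add: g_def[abs_def])
  have "nrm n (\<lambda>i. w $ i - (\<Sum>l<Suc k. r' l * dir n ((v # V) ! l) i) - u $ i) = nrm n (\<lambda>i. g i - f i)"
    by (rule L2_set_cong)
       (auto simp: g_def f_def r'_def q_def c_def sum.lessThan_Suc_shift simp del: sum.lessThan_Suc)
  also have "\<dots> \<le> s * 4 ^ Suc k * \<omega>"
    using nrm_triangle_diff[of g f n] g f e3 by linarith
  finally have A: "nrm n (\<lambda>i. w $ i - (\<Sum>l<Suc k. r' l * dir n ((v # V) ! l) i) - u $ i)
      \<le> s * 4 ^ Suc k * \<omega>" .
  have B: "\<bar>ip n (dir n ((v # V) ! i)) (($) u)
      + (\<Sum>l<Suc k. if i < l then r' l * ip n (dir n ((v # V) ! i)) (dir n ((v # V) ! l)) else 0)\<bar>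
     \<le> s * 4 ^ Suc k * \<omega>" if "i < Suc k" for i
  proof (cases i)
    case 0
    have cw: "ip n c (\<lambda>i. w $ i - h0 * c i) = 0"
      by (simp add: ip_diff_right ip_scale_right ip_self v h0_def)
    have "ip n c (($) u) + (\<Sum>l<k. r l * ip n c (q l))
       = ip n c (\<lambda>i. u $ i + (\<Sum>l<k. r l * q l i))"
      by (simp add: ip_add_right ip_sum_right ip_scale_right)
    also have "\<dots> = ip n c (\<lambda>i. (w $ i - h0 * c i) + (f i - g i))"
      by (rule arg_cong[where f = "ip n c"]) (simp add: fun_eq_iff f_def g_def)
    also have "\<dots> = ip n c (\<lambda>i. f i - g i)"
      using cw by (simp add: ip_add_right)
    finally have "\<bar>ip n c (($) u) + (\<Sum>l<k. r l * ip n c (q l))\<bar> \<le> nrm n (\<lambda>i. f i - g i)"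
      using ip_bound[of n c "\<lambda>i. f i - g i"] v by simp
    also have "\<dots> \<le> s * 4 ^ Suc k * \<omega>"
      using nrm_triangle_diff[of f g n] g f e3 by linarith
    finally show ?thesis
      by (simp add: 0 r'_def q_def c_def sum.lessThan_Suc_shift del: sum.lessThan_Suc)
  next
    case (Suc i')
    then show ?thesis using r2[of i'] that e4
      by (simp add: r'_def q_def sum.lessThan_Suc_shift del: sum.lessThan_Suc cong: if_cong)
  qed
  have "nrm n (($) u) \<le> 3 ^ k * (3 * \<omega>)"
    by (rule order_trans[OF u mult_left_mono[OF w'3]]) simp
  then have C: "nrm n (($) u) \<le> 3 ^ Suc k * \<omega>" by simp
  have k: "length (v # V) = Suc k" by (simp add: k_def)
  have s: "step_const n * 4 ^ Suc k * \<epsilon> * \<omega> = s * 4 ^ Suc k * \<omega>"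
    by (simp add: s_def mult_ac)
  show ?case
    unfolding k \<omega>_def[symmetric] s by (intro conjI exI[of _ r'] allI impI A B C)
qed

definition column_const :: "nat \<Rightarrow> nat \<Rightarrow> real" where
  "column_const n k = (step_const n + 2 * normalize_const n) * 4 ^ k"

lemma column_const_pos: "0 < column_const n k"
  using const_pos[of n] by (simp add: column_const_def)

lemma fl_normalize_nearly_unit:
  assumes "fl_normalize \<epsilon> u v" and n: "dim_vec u = n"
    and eps: "0 \<le> \<epsilon>" and small: "step_const n * \<epsilon> \<le> 1 / 2"
  shows "nearly_unit \<epsilon> n v" "0 < nrm n (($) u)"
    "nrm n (\<lambda>i. u $ i - nrm n (($) u) * dir n v i) \<le> 2 * normalize_const n * \<epsilon> * nrm n (($) u)"
proof -
  define \<nu> where "\<nu> = nrm n (($) u)"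
  define x where "x i = u $ i / \<nu>" for i
  have pos: "0 < \<nu>" and vx: "nrm n (\<lambda>i. v $ i - x i) \<le> normalize_const n * \<epsilon>"
    using fl_normalize_error[OF assms] by (auto simp: \<nu>_def x_def)
  have x1: "nrm n x = 1"
    using nrm_scale[where n = n and c = "1 / \<nu>" and x = "($) u"] pos by (simp add: \<nu>_def x_def[abs_def])
  note near = dir_near[OF x1 vx const_small(2)[OF eps small]]
  show "nearly_unit \<epsilon> n v"
    using near assms(1) n by (auto simp: nearly_unit_def fl_normalize_def)
  show "0 < nrm n (($) u)" using pos by (simp add: \<nu>_def)
  have "nrm n (\<lambda>i. u $ i - \<nu> * dir n v i) = nrm n (\<lambda>i. \<nu> * (x i - dir n v i))"
    using pos by (intro L2_set_cong) (auto simp: x_def algebra_simps)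
  also have "\<dots> = \<nu> * nrm n (\<lambda>i. x i - dir n v i)" using pos by (simp add: nrm_scale)
  also have "\<dots> \<le> \<nu> * (2 * (normalize_const n * \<epsilon>))"
    using near(3) pos by (intro mult_left_mono) auto
  finally show "nrm n (\<lambda>i. u $ i - nrm n (($) u) * dir n v i)
      \<le> 2 * normalize_const n * \<epsilon> * nrm n (($) u)"
    by (simp add: \<nu>_def mult_ac)
qed

text \<open>Since \<open>u\<close> is close to \<open>\<parallel>u\<parallel>\<close> times its computed direction, both estimates extend by a last
  coefficient \<open>r\<^sub>j = \<parallel>u\<parallel>\<close>, the diagonal entry of the triangular factor.\<close>

lemma mgs_column_error:
  assumes mgs: "fl_mgs \<epsilon> V w u" and n: "dim_vec w = n"
    and V: "\<forall>v\<in>set V. nearly_unit \<epsilon> n v"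
    and v: "fl_normalize \<epsilon> u v"
    and eps: "0 \<le> \<epsilon>" and small: "step_const n * \<epsilon> \<le> 1 / 2" and j: "j = length V" "j \<le> k"
  shows "\<exists>r. r j \<noteq> 0 \<and>
    nrm n (\<lambda>i. w $ i - (\<Sum>l\<le>j. r l * dir n ((V @ [v]) ! l) i)) \<le> column_const n k * \<epsilon> * nrm n (($) w) \<and>
    (\<forall>i<j. \<bar>\<Sum>l\<le>j. if i < l then r l * ip n (dir n ((V @ [v]) ! i)) (dir n ((V @ [v]) ! l)) else 0\<bar>
       \<le> column_const n k * \<epsilon> * nrm n (($) w))"
proof -
  define q where "q l = dir n ((V @ [v]) ! l)" for l
  define \<omega> where "\<omega> = nrm n (($) w)"
  define \<nu> where "\<nu> = nrm n (($) u)"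
  define e where "e = step_const n * 4 ^ j * \<epsilon> * \<omega>"
  have \<omega>0: "0 \<le> \<omega>" by (simp add: \<omega>_def)
  have qV: "dir n (V ! l) = q l" if "l < j" for l using that j by (simp add: q_def nth_append)
  have qj: "q j = dir n v" using j by (simp add: q_def)
  have "\<exists>r. \<nu> \<le> 3 ^ j * \<omega> \<and>
      nrm n (\<lambda>i. w $ i - (\<Sum>l<j. r l * dir n (V ! l) i) - u $ i) \<le> e \<and>
      (\<forall>i<j. \<bar>ip n (dir n (V ! i)) (($) u)
          + (\<Sum>l<j. if i < l then r l * ip n (dir n (V ! i)) (dir n (V ! l)) else 0)\<bar> \<le> e)"
    using fl_mgs_error[OF mgs n V eps small] by (simp add: \<nu>_def \<omega>_def e_def j)
  then obtain r where \<nu>3: "\<nu> \<le> 3 ^ j * \<omega>"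
    and r1: "nrm n (\<lambda>i. w $ i - (\<Sum>l<j. r l * q l i) - u $ i) \<le> e"
    and r2: "\<And>i. i < j \<Longrightarrow> \<bar>ip n (q i) (($) u)
          + (\<Sum>l<j. if i < l then r l * ip n (q i) (q l) else 0)\<bar> \<le> e"
    by (auto simp: qV cong: if_cong)
  have du: "dim_vec u = n" using fl_mgs_dim[OF mgs] n by simp
  note nu = fl_normalize_nearly_unit[OF v du eps small]
  define f where "f i = u $ i - \<nu> * q j i" for i
  have "nrm n f \<le> 2 * normalize_const n * \<epsilon> * \<nu>" using nu(3) by (simp add: f_def[abs_def] \<nu>_def qj)
  also have "\<dots> \<le> 2 * normalize_const n * \<epsilon> * (3 ^ j * \<omega>)"
    using \<nu>3 eps const_pos[of n] by (intro mult_left_mono) auto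
  also have "\<dots> \<le> 2 * normalize_const n * \<epsilon> * (4 ^ j * \<omega>)"
    using \<omega>0 eps const_pos[of n] by (intro mult_left_mono mult_right_mono power_mono) auto
  finally have "nrm n f + e \<le> (step_const n + 2 * normalize_const n) * 4 ^ j * (\<epsilon> * \<omega>)"
    by (simp add: e_def algebra_simps)
  also have "\<dots> \<le> column_const n k * (\<epsilon> * \<omega>)"
    unfolding column_const_def using \<omega>0 eps const_pos[of n] j(2)
    by (intro mult_right_mono mult_left_mono power_increasing) auto
  finally have fe: "nrm n f + e \<le> column_const n k * \<epsilon> * \<omega>" by simp
  define r' where "r' = r(j := \<nu>)"
  have split: "(\<Sum>l\<le>j. F l) = (\<Sum>l<j. F l) + F j" for F :: "nat \<Rightarrow> real"
    by (metis lessThan_Suc_atMost sum.lessThan_Suc)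
  have sum1: "(\<Sum>l\<le>j. r' l * q l i) = (\<Sum>l<j. r l * q l i) + \<nu> * q j i" for i
    unfolding split by (simp add: r'_def)
  have "nrm n (\<lambda>i. w $ i - (\<Sum>l\<le>j. r' l * q l i))
      = nrm n (\<lambda>i. (w $ i - (\<Sum>l<j. r l * q l i) - u $ i) + f i)"
    by (simp add: sum1 f_def algebra_simps)
  also have "\<dots> \<le> column_const n k * \<epsilon> * \<omega>"
    using nrm_triangle[of "\<lambda>i. w $ i - (\<Sum>l<j. r l * q l i) - u $ i" f n] r1 fe by linarith
  finally have A: "nrm n (\<lambda>i. w $ i - (\<Sum>l\<le>j. r' l * q l i)) \<le> column_const n k * \<epsilon> * \<omega>" .
  have B: "\<bar>\<Sum>l\<le>j. if i < l then r' l * ip n (q i) (q l) else 0\<bar> \<le> column_const n k * \<epsilon> * \<omega>"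
    if i: "i < j" for i
  proof -
    have "nearly_unit \<epsilon> n (V ! i)" using V i j by simp
    then have "nrm n (q i) = 1" using qV[OF i] by (simp add: nearly_unit_def)
    then have "\<bar>ip n (q i) f\<bar> \<le> nrm n f" using ip_bound[of n "q i" f] by simp
    moreover have "ip n (q i) f = ip n (q i) (($) u) - \<nu> * ip n (q i) (q j)"
      by (simp add: f_def[abs_def] ip_diff_right ip_scale_right)
    moreover have "(\<Sum>l\<le>j. if i < l then r' l * ip n (q i) (q l) else 0)
       = (\<Sum>l<j. if i < l then r l * ip n (q i) (q l) else 0) + \<nu> * ip n (q i) (q j)"
      unfolding split using i by (simp add: r'_def cong: if_cong)
    ultimately show ?thesis using r2[OF i] fe by linarith
  qed
  have "r' j \<noteq> 0" using nu(2) by (simp add: r'_def \<nu>_def)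
  with A B show ?thesis unfolding q_def \<omega>_def by blast
qed

text \<open>The process is MGS applied to the columns of \<open>[b, W]\<close>. The first column fits the pattern
  because it is orthogonalised against the empty list.\<close>

lemma fl_arnoldi_columns:
  assumes "fl_arnoldi \<epsilon> A b k V W" and "A \<in> carrier_mat n n" "b \<in> carrier_vec n"
  shows "length V = Suc k \<and> length W = k \<and> set W \<subseteq> carrier_vec n \<and>
    (\<forall>j\<le>k. \<exists>u. dim_vec u = n \<and> fl_mgs \<epsilon> (take j V) ((b # W) ! j) u \<and> fl_normalize \<epsilon> u (V ! j))"
  using assms
proof (induction rule: fl_arnoldi.induct)
  case (start v)
  then show ?case using fl_mgs.Nil[of \<epsilon> b] by (auto intro!: exI[of _ b])
next
  case (step k V W w u v)
  then have IH: "length V = Suc k" "length W = k" "set W \<subseteq> carrier_vec n"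
    "\<forall>j\<le>k. \<exists>u. dim_vec u = n \<and> fl_mgs \<epsilon> (take j V) ((b # W) ! j) u \<and> fl_normalize \<epsilon> u (V ! j)"
    by auto
  have w: "w \<in> carrier_vec n" using step by (auto simp: fl_mult_mat_vec_def)
  have "\<exists>u. dim_vec u = n \<and> fl_mgs \<epsilon> (take j (V @ [v])) ((b # W @ [w]) ! j) u
      \<and> fl_normalize \<epsilon> u ((V @ [v]) ! j)" if "j \<le> Suc k" for j
  proof (cases "j = Suc k")
    case True
    have "dim_vec u = n" using fl_mgs_dim[OF step.hyps(3)] w by simp
    then show ?thesis using step.hyps IH True by (auto simp: nth_append)
  next
    case False
    then have "j \<le> k" using that by simp
    moreover have "(b # W @ [w]) ! j = (b # W) ! j"
      using \<open>j \<le> k\<close> IH(2) by (metis append_Cons le_imp_less_Suc length_Cons nth_append)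
    ultimately show ?thesis using IH by (simp add: nth_append)
  qed
  then show ?case using IH w by auto
qed

section \<open>Loss of orthogonality\<close>

lemma upper_triangular_solvable:
  fixes M :: "nat \<Rightarrow> nat \<Rightarrow> real"
  assumes "\<And>j. j < m \<Longrightarrow> M j j \<noteq> 0" and "\<And>l j. j < l \<Longrightarrow> l < m \<Longrightarrow> M l j = 0"
  shows "\<exists>x. \<forall>l<m. (\<Sum>j<m. M l j * x j) = u l"
  using assms
proof (induction m arbitrary: u)
  case (Suc m)
  define t where "t = u m / M m m"
  have "\<exists>x. \<forall>l<m. (\<Sum>j<m. M l j * x j) = u l - M l m * t"
    using Suc.prems by (intro Suc.IH) auto
  then obtain x where x: "\<And>l. l < m \<Longrightarrow> (\<Sum>j<m. M l j * x j) = u l - M l m * t" by auto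
  have same: "(\<Sum>j<m. M l j * (x(m := t)) j) = (\<Sum>j<m. M l j * x j)" for l
    by (rule sum.cong) auto
  have "(\<Sum>j<Suc m. M l j * (x(m := t)) j) = u l" if "l < Suc m" for l
  proof (cases "l = m")
    case True
    have "(\<Sum>j<m. M m j * x j) = 0" using Suc.prems(2) by (intro sum.neutral) auto
    then show ?thesis using True Suc.prems(1)[of m] same by (simp add: t_def)
  next
    case False
    then show ?thesis using that x[of l] same by simp
  qed
  then show ?case by blast
qed simp

text \<open>
  The rows \<open>u\<close> of the strict upper triangle of \<open>Q\<^sup>T Q\<close> satisfy \<open>u R = g\<close> with \<open>g\<close> of the size of
  the rounding errors, so that \<open>\<parallel>u\<parallel>\<close> is bounded by the error divided by the smallest singular
  value of \<open>R D\<close>; and that singular value is at least \<open>\<sigma> / (2 sqrt m)\<close>, where \<open>\<sigma>\<close> belongs to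
  \<open>A D \<approx> Q R D\<close>, because \<open>Q\<close> has norm at most \<open>sqrt m\<close>. The comparison needs the backward error
  to be below \<open>\<sigma> / 2\<close>; otherwise the bound exceeds \<open>1\<close>, which dominates any inner product of
  unit vectors.
\<close>

lemma loss_of_orthogonality:
  fixes q a r :: "nat \<Rightarrow> nat \<Rightarrow> real"
  assumes unit: "\<And>j. j < m \<Longrightarrow> nrm n (q j) = 1"
    and upper: "\<And>l j. j < l \<Longrightarrow> l < m \<Longrightarrow> r l j = 0"
    and diag: "\<And>j. j < m \<Longrightarrow> r j j \<noteq> 0"
    and fact: "\<And>j. j < m \<Longrightarrow> nrm n (\<lambda>i. a j i - (\<Sum>l<m. r l j * q l i)) \<le> \<delta> * nrm n (a j)"
    and orth: "\<And>i j. i < m \<Longrightarrow> j < m \<Longrightarrow>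
       \<bar>\<Sum>l<m. (if i < l then ip n (q i) (q l) else 0) * r l j\<bar> \<le> \<delta> * nrm n (a j)"
    and d: "\<And>j. j < m \<Longrightarrow> 0 < d j" and \<delta>: "0 \<le> \<delta>"
    and \<sigma>: "0 < \<sigma>" and low: "\<And>x. \<sigma> * nrm m x \<le> nrm n (\<lambda>i. \<Sum>j<m. x j * (d j * a j i))"
    and ij: "i < j" "j < m"
  shows "\<bar>ip n (q i) (q j)\<bar> \<le> 2 * real m * \<delta> * nrm m (\<lambda>j. d j * nrm n (a j)) / \<sigma>"
proof -
  define P where "P = nrm m (\<lambda>j. d j * nrm n (a j))"
  have m: "1 \<le> real m" using ij by simp
  have P0: "0 \<le> P" by (simp add: P_def)
  show ?thesis
  proof (cases "2 * \<delta> * P \<le> \<sigma>")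
    case False
    then have "1 \<le> 2 * \<delta> * P / \<sigma>" using \<sigma> by (simp add: le_divide_eq)
    also have "\<dots> \<le> real m * (2 * \<delta> * P / \<sigma>)"
      using m P0 \<delta> \<sigma> mult_right_mono[of 1 "real m" "2 * \<delta> * P / \<sigma>"] by simp
    finally have "1 \<le> 2 * real m * \<delta> * P / \<sigma>" by (simp add: mult_ac)
    moreover have "\<bar>ip n (q i) (q j)\<bar> \<le> 1"
      using ip_bound[of n "q i" "q j"] unit ij by simp
    ultimately show ?thesis unfolding P_def by linarith
  next
    case True
    define u where "u l = (if i < l then ip n (q i) (q l) else 0)" for l
    define M where "M l j = r l j * d j" for l j
    have "\<exists>x. \<forall>l<m. (\<Sum>j<m. M l j * x j) = u l"
      using upper diag d by (intro upper_triangular_solvable) (fastforce simp: M_def)+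
    then obtain x where x: "\<And>l. l < m \<Longrightarrow> (\<Sum>j<m. M l j * x j) = u l" by auto
    have dx: "(\<Sum>j<m. \<bar>x j\<bar> * (d j * nrm n (a j))) \<le> nrm m x * P"
    proof -
      have "(\<Sum>j<m. \<bar>x j\<bar> * (d j * nrm n (a j))) = (\<Sum>j<m. \<bar>x j\<bar> * \<bar>d j * nrm n (a j)\<bar>)"
        using d by (intro sum.cong) (auto simp: abs_mult less_imp_le)
      then show ?thesis unfolding P_def using L2_set_mult_ineq by metis
    qed
    define E where "E j i = a j i - (\<Sum>l<m. r l j * q l i)" for j i
    have "(\<Sum>j<m. x j * (d j * a j i)) = (\<Sum>j<m. (x j * d j) * E j i) + (\<Sum>l<m. u l * q l i)" for i
    proof -
      have "(\<Sum>l<m. u l * q l i) = (\<Sum>l<m. \<Sum>j<m. M l j * x j * q l i)"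
        by (intro sum.cong refl) (simp add: x[symmetric] sum_distrib_right)
      also have "\<dots> = (\<Sum>j<m. \<Sum>l<m. M l j * x j * q l i)" by (rule sum.swap)
      also have "\<dots> = (\<Sum>j<m. (x j * d j) * (\<Sum>l<m. r l j * q l i))"
        by (simp add: sum_distrib_left M_def mult_ac)
      finally show ?thesis
        by (simp add: E_def sum.distrib[symmetric] algebra_simps)
    qed
    then have "nrm n (\<lambda>i. \<Sum>j<m. x j * (d j * a j i))
       \<le> nrm n (\<lambda>i. \<Sum>j<m. (x j * d j) * E j i) + nrm n (\<lambda>i. \<Sum>l<m. u l * q l i)"
      by (simp add: nrm_triangle)
    also have "nrm n (\<lambda>i. \<Sum>j<m. (x j * d j) * E j i) \<le> (\<Sum>j<m. nrm n (\<lambda>i. (x j * d j) * E j i))"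
      by (rule nrm_sum)
    also have "\<dots> \<le> (\<Sum>j<m. \<delta> * (\<bar>x j\<bar> * (d j * nrm n (a j))))"
    proof (rule sum_mono)
      fix j assume "j \<in> {..<m}"
      then have j: "j < m" by simp
      have "nrm n (\<lambda>i. (x j * d j) * E j i) = \<bar>x j\<bar> * d j * nrm n (E j)"
        using d[OF j] by (simp add: nrm_scale abs_mult)
      also have "\<dots> \<le> \<bar>x j\<bar> * d j * (\<delta> * nrm n (a j))"
        using fact[OF j] d[OF j] by (intro mult_left_mono) (auto simp: E_def[abs_def])
      finally show "nrm n (\<lambda>i. (x j * d j) * E j i) \<le> \<delta> * (\<bar>x j\<bar> * (d j * nrm n (a j)))"
        by (simp add: mult_ac)
    qed
    also have "\<dots> \<le> \<delta> * (nrm m x * P)"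
      unfolding sum_distrib_left[symmetric] using dx \<delta> by (rule mult_left_mono)
    also have "nrm n (\<lambda>i. \<Sum>l<m. u l * q l i) \<le> (\<Sum>l<m. nrm n (\<lambda>i. u l * q l i))"
      by (rule nrm_sum)
    also have "\<dots> = (\<Sum>l<m. \<bar>u l\<bar>)" by (intro sum.cong) (auto simp: nrm_scale unit)
    also have "\<dots> \<le> sqrt m * nrm m u" by (rule sum_abs_le_nrm)
    finally have "\<sigma> * nrm m x \<le> \<delta> * (nrm m x * P) + sqrt m * nrm m u"
      using low[of x] by linarith
    moreover have "2 * \<delta> * P * nrm m x \<le> \<sigma> * nrm m x" using True by (rule mult_right_mono) simp
    ultimately have xb: "\<sigma> * nrm m x \<le> 2 * sqrt m * nrm m u" by (simp add: mult_ac)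
    define g where "g j = (\<Sum>l<m. u l * r l j)" for j
    have "(nrm m u)\<^sup>2 = (\<Sum>l<m. u l * (\<Sum>j<m. M l j * x j))"
      unfolding nrm_sq by (intro sum.cong) (auto simp: x power2_eq_square)
    also have "\<dots> = (\<Sum>l<m. \<Sum>j<m. u l * (M l j * x j))" by (simp add: sum_distrib_left)
    also have "\<dots> = (\<Sum>j<m. \<Sum>l<m. u l * (M l j * x j))" by (rule sum.swap)
    also have "\<dots> = (\<Sum>j<m. x j * d j * g j)"
      by (simp add: g_def M_def sum_distrib_left mult_ac)
    also have "\<dots> \<le> (\<Sum>j<m. \<delta> * (\<bar>x j\<bar> * (d j * nrm n (a j))))"
    proof (rule sum_mono)
      fix j assume "j \<in> {..<m}"
      then have j: "j < m" by simp
      have "i < m" using ij by simp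
      have "x j * d j * g j \<le> \<bar>x j\<bar> * d j * \<bar>g j\<bar>"
        using d[OF j] abs_ge_self[of "x j * d j * g j"] by (simp add: abs_mult)
      also have "\<dots> \<le> \<bar>x j\<bar> * d j * (\<delta> * nrm n (a j))"
        using orth[OF \<open>i < m\<close> j] d[OF j] by (intro mult_left_mono) (auto simp: g_def u_def)
      finally show "x j * d j * g j \<le> \<delta> * (\<bar>x j\<bar> * (d j * nrm n (a j)))"
        by (simp add: mult_ac)
    qed
    also have "\<dots> \<le> \<delta> * (nrm m x * P)"
      unfolding sum_distrib_left[symmetric] using dx \<delta> by (rule mult_left_mono)
    finally have "\<sigma> * (nrm m u)\<^sup>2 \<le> \<sigma> * (\<delta> * (nrm m x * P))"
      using \<sigma> by (intro mult_left_mono) auto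
    also have "\<dots> = \<delta> * P * (\<sigma> * nrm m x)" by (simp add: mult_ac)
    also have "\<dots> \<le> \<delta> * P * (2 * sqrt m * nrm m u)"
      using xb \<delta> P0 by (intro mult_left_mono) auto
    finally have "nrm m u * (\<sigma> * nrm m u) \<le> nrm m u * (2 * sqrt m * \<delta> * P)"
      by (simp add: power2_eq_square mult_ac)
    then have "\<sigma> * nrm m u \<le> 2 * sqrt m * \<delta> * P"
      using P0 \<delta> by (cases "nrm m u = 0") (auto simp: order.strict_iff_order)
    also have "\<dots> \<le> 2 * real m * \<delta> * P"
      using m P0 \<delta> real_sqrt_le_mono[of "real m" "(real m)\<^sup>2"]
      by (intro mult_right_mono) (auto simp: power2_eq_square)
    finally have "nrm m u \<le> 2 * real m * \<delta> * P / \<sigma>"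
      using \<sigma> by (simp add: le_divide_eq mult.commute)
    moreover have "\<bar>ip n (q i) (q j)\<bar> \<le> nrm m u"
      using coord_le_nrm[OF ij(2), of u] ij by (simp add: u_def)
    ultimately show ?thesis unfolding P_def by linarith
  qed
qed


section \<open>Singular values and column scalings\<close>

lemma gram_index:
  "M \<in> carrier_mat n m \<Longrightarrow> i < m \<Longrightarrow> j < m \<Longrightarrow>
    (transpose_mat M * M) $$ (i, j) = ip n (\<lambda>l. M $$ (l, i)) (\<lambda>l. M $$ (l, j))"
  by (auto simp: scalar_prod_def ip_def atLeast0LessThan intro!: sum.cong)

lemma gram_form:
  assumes M: "M \<in> carrier_mat n m"
  shows "ip m x (\<lambda>i. ip m (\<lambda>j. (transpose_mat M * M) $$ (i, j)) x)
    = (nrm n (\<lambda>i. \<Sum>j<m. x j * M $$ (i, j)))\<^sup>2"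
proof -
  have "ip m x (\<lambda>i. ip m (\<lambda>j. (transpose_mat M * M) $$ (i, j)) x)
      = (\<Sum>i<m. x i * (\<Sum>j<m. ip n (\<lambda>l. M $$ (l, i)) (\<lambda>l. M $$ (l, j)) * x j))"
    unfolding ip_def[of m] by (intro sum.cong refl arg_cong2[where f = "(*)"]) (simp_all add: gram_index[OF M])
  also have "\<dots> = (\<Sum>i<m. \<Sum>j<m. \<Sum>l<n. x i * M $$ (l, i) * (x j * M $$ (l, j)))"
    by (simp add: ip_def sum_distrib_left sum_distrib_right mult_ac)
  also have "\<dots> = (\<Sum>i<m. \<Sum>l<n. \<Sum>j<m. x i * M $$ (l, i) * (x j * M $$ (l, j)))"
    by (intro sum.cong refl sum.swap)
  also have "\<dots> = (\<Sum>l<n. \<Sum>i<m. \<Sum>j<m. x i * M $$ (l, i) * (x j * M $$ (l, j)))"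
    by (rule sum.swap)
  also have "\<dots> = (nrm n (\<lambda>i. \<Sum>j<m. x j * M $$ (i, j)))\<^sup>2"
    unfolding nrm_sq by (simp add: power2_eq_square sum_product)
  finally show ?thesis .
qed

lemma finite_singular_values:
  assumes M: "M \<in> carrier_mat n m"
  shows "finite (singular_values M)"
proof -
  have G: "transpose_mat M * M \<in> carrier_mat m m" using M by simp
  have "char_poly (transpose_mat M * M) \<noteq> 0"
    using degree_monic_char_poly[OF G] by auto
  then have "finite {l. poly (char_poly (transpose_mat M * M)) l = 0}" by (rule poly_roots_finite)
  moreover have "{l. eigenvalue (transpose_mat M * M) l}
      = {l. poly (char_poly (transpose_mat M * M)) l = 0}"
    using eigenvalue_root_char_poly[OF G] by blast
  ultimately have "finite {l. eigenvalue (transpose_mat M * M) l}" by metis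
  then show ?thesis by (simp add: singular_values_def)
qed

lemma gram_eigenvector:
  assumes M: "M \<in> carrier_mat n m" and l: "eigenvalue (transpose_mat M * M) l"
  shows "\<exists>x. 0 < nrm m x \<and> l * (nrm m x)\<^sup>2 = (nrm n (\<lambda>i. \<Sum>j<m. x j * M $$ (i, j)))\<^sup>2"
proof -
  have G: "transpose_mat M * M \<in> carrier_mat m m" using M by simp
  obtain v where v: "v \<in> carrier_vec m" "v \<noteq> 0\<^sub>v m" "(transpose_mat M * M) *\<^sub>v v = l \<cdot>\<^sub>v v"
    using l M by (auto simp: eigenvalue_def eigenvector_def)
  obtain i where "i < m" "v $ i \<noteq> 0" using v(1,2) by (metis carrier_vecD eq_vecI index_zero_vec(1,2))
  then have pos: "0 < nrm m (($) v)" by (rule nrm_pos)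
  have "ip m (\<lambda>j. (transpose_mat M * M) $$ (i, j)) (($) v) = l * v $ i" if "i < m" for i
    using mult_mat_vec_ip[OF G v(1) that] v that by (metis carrier_vecD index_smult_vec(1))
  then have "ip m (($) v) (\<lambda>i. ip m (\<lambda>j. (transpose_mat M * M) $$ (i, j)) (($) v))
      = ip m (($) v) (\<lambda>i. l * v $ i)"
    unfolding ip_def[of m "($) v"] by simp
  then show ?thesis
    using pos unfolding gram_form[OF M] by (intro exI[of _ "($) v"]) (simp add: ip_scale_right ip_self)
qed

lemma gram_eigenvalue_nonneg:
  fixes M :: "real mat"
  assumes "M \<in> carrier_mat n m" "eigenvalue (transpose_mat M * M) l"
  shows "0 \<le> l"
  using gram_eigenvector[OF assms] by (metis zero_le_mult_iff zero_le_power2 zero_less_power not_le)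

lemma singular_values_nonempty:
  assumes M: "M \<in> carrier_mat n m" and m: "0 < m"
  shows "singular_values M \<noteq> {}"
proof -
  have G: "transpose_mat M * M \<in> carrier_mat m m" using M by simp
  have "\<exists>l. eigenvalue (transpose_mat M * M) l"
    using symmetric_eigenvalue_le_rayleigh[OF G m] gram_index[OF M]
    by (auto simp: ip_def mult.commute)
  then show ?thesis by (auto simp: singular_values_def)
qed

lemma sigma_min_nonneg:
  assumes M: "M \<in> carrier_mat n m" and m: "0 < m"
  shows "0 \<le> sigma_min M"
proof -
  have "sigma_min M \<in> singular_values M"
    unfolding sigma_min_def using finite_singular_values[OF M] singular_values_nonempty[OF M m] by simp
  then show ?thesis using gram_eigenvalue_nonneg[OF M] by (auto simp: singular_values_def)
qed

text \<open>The squared norm of the image is the quadratic form of the Gram matrix, whose least value on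
  the unit sphere is an eigenvalue and hence at least the square of the smallest singular value.\<close>

lemma sigma_min_le:
  assumes M: "M \<in> carrier_mat n m" and m: "0 < m"
  shows "sigma_min M * nrm m x \<le> nrm n (\<lambda>i. \<Sum>j<m. x j * M $$ (i, j))"
proof -
  have G: "transpose_mat M * M \<in> carrier_mat m m" using M by simp
  have "\<exists>l. eigenvalue (transpose_mat M * M) l \<and>
      (\<forall>y. l * (nrm m y)\<^sup>2 \<le> ip m y (\<lambda>i. ip m (\<lambda>j. (transpose_mat M * M) $$ (i, j)) y))"
    by (rule symmetric_eigenvalue_le_rayleigh[OF G m])
       (simp only: gram_index[OF M], simp add: ip_def mult.commute)
  then obtain l where l: "eigenvalue (transpose_mat M * M) l"
    and le: "l * (nrm m x)\<^sup>2 \<le> (nrm n (\<lambda>i. \<Sum>j<m. x j * M $$ (i, j)))\<^sup>2"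
    unfolding gram_form[OF M] by blast
  have l0: "0 \<le> l" by (rule gram_eigenvalue_nonneg[OF M l])
  have "sigma_min M \<le> sqrt l"
    unfolding sigma_min_def using finite_singular_values[OF M] l
    by (intro Min_le) (auto simp: singular_values_def)
  then have "sigma_min M * nrm m x \<le> sqrt l * nrm m x" by (rule mult_right_mono) simp
  also have "\<dots> \<le> nrm n (\<lambda>i. \<Sum>j<m. x j * M $$ (i, j))"
    by (rule power2_le_imp_le) (use le l0 in \<open>simp_all add: power_mult_distrib\<close>)
  finally show ?thesis .
qed

lemma le_sigma_max:
  assumes M: "M \<in> carrier_mat n m" and m: "0 < m"
  shows "nrm n (\<lambda>i. \<Sum>j<m. x j * M $$ (i, j)) \<le> sigma_max M * nrm m x"
proof -
  \<comment> \<open>The largest eigenvalue of the Gram matrix is minus the smallest one of its negative.\<close>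
  define G where "G = transpose_mat M * M"
  have G: "G \<in> carrier_mat m m" using M by (simp add: G_def)
  have "\<exists>l. eigenvalue (- G) l \<and> (\<forall>y. l * (nrm m y)\<^sup>2 \<le> ip m y (\<lambda>i. ip m (\<lambda>j. (- G) $$ (i, j)) y))"
  proof (rule symmetric_eigenvalue_le_rayleigh[OF _ m])
    show "- G \<in> carrier_mat m m" using G by simp
    show "(- G) $$ (i, j) = (- G) $$ (j, i)" if "i < m" "j < m" for i j
      using that G gram_index[OF M, of i j] gram_index[OF M, of j i]
      by (simp add: G_def[symmetric] ip_def mult.commute)
  qed
  then obtain l where l: "eigenvalue (- G) l"
    and le: "l * (nrm m x)\<^sup>2 \<le> ip m x (\<lambda>i. ip m (\<lambda>j. (- G) $$ (i, j)) x)" by blast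
  have "ip m (\<lambda>j. (- G) $$ (i, j)) x = (-1) * ip m (\<lambda>j. G $$ (i, j)) x" if "i < m" for i
    using that G by (simp add: ip_def sum_negf)
  then have "ip m x (\<lambda>i. ip m (\<lambda>j. (- G) $$ (i, j)) x)
      = ip m x (\<lambda>i. (-1) * ip m (\<lambda>j. G $$ (i, j)) x)"
    unfolding ip_def[of m x] by simp
  also have "\<dots> = - ((nrm n (\<lambda>i. \<Sum>j<m. x j * M $$ (i, j)))\<^sup>2)"
    unfolding ip_scale_right G_def gram_form[OF M] by simp
  finally have le': "(nrm n (\<lambda>i. \<Sum>j<m. x j * M $$ (i, j)))\<^sup>2 \<le> (- l) * (nrm m x)\<^sup>2"
    using le by simp
  obtain v where v: "v \<in> carrier_vec m" "v \<noteq> 0\<^sub>v m" "(- G) *\<^sub>v v = l \<cdot>\<^sub>v v"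
    using l G by (auto simp: eigenvalue_def eigenvector_def)
  have "G *\<^sub>v v = (- l) \<cdot>\<^sub>v v"
  proof (rule eq_vecI)
    fix i assume "i < dim_vec ((- l) \<cdot>\<^sub>v v)"
    then have i: "i < m" using v by simp
    have "- (G *\<^sub>v v) = l \<cdot>\<^sub>v v" using v G by simp
    then have "(- (G *\<^sub>v v)) $ i = (l \<cdot>\<^sub>v v) $ i" by simp
    then show "(G *\<^sub>v v) $ i = ((- l) \<cdot>\<^sub>v v) $ i" using v G i by simp
  qed (use v G in simp)
  then have ev: "eigenvalue (transpose_mat M * M) (- l)"
    using v(1,2) M unfolding eigenvalue_def eigenvector_def G_def by auto
  have l0: "0 \<le> - l" by (rule gram_eigenvalue_nonneg[OF M ev])
  have "sqrt (- l) \<le> sigma_max M"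
    unfolding sigma_max_def using finite_singular_values[OF M] ev
    by (intro Max_ge) (auto simp: singular_values_def)
  then have "sqrt (- l) * nrm m x \<le> sigma_max M * nrm m x" by (rule mult_right_mono) simp
  moreover have "nrm n (\<lambda>i. \<Sum>j<m. x j * M $$ (i, j)) \<le> sqrt (- l) * nrm m x"
    by (rule power2_le_imp_le) (use le' l0 in \<open>simp_all add: power_mult_distrib\<close>)
  ultimately show ?thesis by linarith
qed

lemma sigma_min_pos_of_injective:
  assumes M: "M \<in> carrier_mat n m" and m: "0 < m"
    and inj: "\<And>x. 0 < nrm m x \<Longrightarrow> 0 < nrm n (\<lambda>i. \<Sum>j<m. x j * M $$ (i, j))"
  shows "0 < sigma_min M"
proof -
  have "sigma_min M \<in> singular_values M"
    unfolding sigma_min_def using finite_singular_values[OF M] singular_values_nonempty[OF M m] by simp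
  then obtain l where l: "eigenvalue (transpose_mat M * M) l" "sigma_min M = sqrt l"
    by (auto simp: singular_values_def)
  obtain x where x: "0 < nrm m x" "l * (nrm m x)\<^sup>2 = (nrm n (\<lambda>i. \<Sum>j<m. x j * M $$ (i, j)))\<^sup>2"
    using gram_eigenvector[OF M l(1)] by blast
  have "0 < (nrm n (\<lambda>i. \<Sum>j<m. x j * M $$ (i, j)))\<^sup>2" using inj[OF x(1)] by simp
  then have "l \<noteq> 0" using x(2) by auto
  then show ?thesis using l gram_eigenvalue_nonneg[OF M l(1)] by simp
qed

lemma mult_diag_index:
  assumes M: "M \<in> carrier_mat n m" and D: "D \<in> pos_diag_mats m" and i: "i < n" and j: "j < m"
  shows "(M * D) $$ (i, j) = D $$ (j, j) * M $$ (i, j)"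
proof -
  have D': "D \<in> carrier_mat m m" "\<And>l. l < m \<Longrightarrow> l \<noteq> j \<Longrightarrow> D $$ (l, j) = 0"
    using D j by (auto simp: pos_diag_mats_def diagonal_mat_def)
  have "(M * D) $$ (i, j) = (\<Sum>l<m. M $$ (i, l) * D $$ (l, j))"
    using M D' i j by (auto simp: scalar_prod_def atLeast0LessThan intro!: sum.cong)
  also have "\<dots> = (\<Sum>l<m. if l = j then M $$ (i, j) * D $$ (j, j) else 0)"
    using D' by (intro sum.cong) auto
  finally show ?thesis using j by simp
qed

text \<open>Column scaling preserves full rank. Without this the quotient in \<^const>\<open>scaled_cond_num\<close>
  could be a division by zero with value \<open>0\<close>, which would spoil the infimum.\<close>

lemma sigma_min_mult_diag_pos:
  assumes M: "M \<in> carrier_mat n m" and m: "0 < m" and \<sigma>: "sigma_min M \<noteq> 0"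
    and D: "D \<in> pos_diag_mats m"
  shows "0 < sigma_min (M * D)"
proof (rule sigma_min_pos_of_injective[OF _ m])
  show "M * D \<in> carrier_mat n m" using M D by (auto simp: pos_diag_mats_def)
  fix x assume x: "0 < nrm m x"
  have pos: "0 < D $$ (j, j)" if "j < m" for j using D that by (auto simp: pos_diag_mats_def)
  define y where "y j = D $$ (j, j) * x j" for j
  have "\<not> (\<forall>j\<in>{..<m}. x j = 0)" using x by (metis L2_set_0' less_irrefl)
  then obtain j where "j < m" "x j \<noteq> 0" by auto
  then have "0 < nrm m y" using pos[of j] by (intro nrm_pos[of j]) (auto simp: y_def)
  then have "0 < sigma_min M * nrm m y" using \<sigma> sigma_min_nonneg[OF M m] by simp
  also have "\<dots> \<le> nrm n (\<lambda>i. \<Sum>j<m. y j * M $$ (i, j))" by (rule sigma_min_le[OF M m])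
  also have "\<dots> = nrm n (\<lambda>i. \<Sum>j<m. x j * (M * D) $$ (i, j))"
    by (intro L2_set_cong sum.cong refl) (simp add: mult_diag_index[OF M D] y_def)
  finally show "0 < nrm n (\<lambda>i. \<Sum>j<m. x j * (M * D) $$ (i, j))" .
qed

lemma frob_norm_columns:
  assumes M: "M \<in> carrier_mat n m"
  shows "frob_norm M = nrm m (\<lambda>j. nrm n (\<lambda>i. M $$ (i, j)))"
proof -
  have "(\<Sum>i<n. \<Sum>j<m. (M $$ (i, j))\<^sup>2) = (\<Sum>j<m. (nrm n (\<lambda>i. M $$ (i, j)))\<^sup>2)"
    unfolding nrm_sq by (rule sum.swap)
  then show ?thesis
    using M by (simp add: frob_norm_def L2_set_def[of "\<lambda>j. nrm n (\<lambda>i. M $$ (i, j))"])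
qed

lemma frob_norm_nonneg: "0 \<le> frob_norm M"
  by (simp add: frob_norm_def sum_nonneg)

lemma entry_le_frob_norm:
  assumes M: "M \<in> carrier_mat n m" and ij: "i < n" "j < m"
  shows "\<bar>M $$ (i, j)\<bar> \<le> frob_norm M"
proof -
  have "\<bar>M $$ (i, j)\<bar> \<le> nrm n (\<lambda>i. M $$ (i, j))" by (rule coord_le_nrm[OF ij(1)])
  also have "\<dots> \<le> nrm m (\<lambda>j. nrm n (\<lambda>i. M $$ (i, j)))"
    using coord_le_nrm[OF ij(2), of "\<lambda>j. nrm n (\<lambda>i. M $$ (i, j))"] by simp
  finally show ?thesis by (simp add: frob_norm_columns[OF M])
qed

lemma frob_norm_le_entries:
  assumes M: "M \<in> carrier_mat k k" and X: "0 \<le> X"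
    and le: "\<And>i j. i < k \<Longrightarrow> j < k \<Longrightarrow> \<bar>M $$ (i, j)\<bar> \<le> X"
  shows "frob_norm M \<le> k * X"
proof -
  have "(\<Sum>i<k. \<Sum>j<k. (M $$ (i, j))\<^sup>2) \<le> (\<Sum>i<k. \<Sum>j<k. X\<^sup>2)"
    using le X by (intro sum_mono) (simp add: abs_le_square_iff[symmetric])
  also have "\<dots> = (k * X)\<^sup>2" by (simp add: power2_eq_square)
  finally show ?thesis using M X by (simp add: frob_norm_def real_le_lsqrt)
qed

text \<open>The scaling \<open>D = I\<close> competes in the infimum, and each of the \<open>m\<close> columns of \<open>M\<close>, being the
  image of a unit vector, has norm at most \<open>\<sigma>\<^sub>m\<^sub>a\<^sub>x\<close>.\<close>

lemma scaled_cond_num_le: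
  assumes M: "M \<in> carrier_mat n m" and m: "0 < m" and \<sigma>: "sigma_min M \<noteq> 0"
  shows "scaled_cond_num M \<le> sqrt m * cond_num M" and "0 \<le> scaled_cond_num M"
proof -
  define f where "f D = frob_norm (M * D) / sigma_min (M * D)" for D
  have one: "1\<^sub>m m \<in> pos_diag_mats m" by (auto simp: pos_diag_mats_def diagonal_mat_def)
  have f0: "0 \<le> f D" if "D \<in> pos_diag_mats m" for D
    unfolding f_def using frob_norm_nonneg sigma_min_mult_diag_pos[OF M m \<sigma> that]
    by (simp add: less_imp_le)
  have s: "scaled_cond_num M = (INF D\<in>pos_diag_mats m. f D)"
    using M by (simp add: scaled_cond_num_def f_def)
  show "0 \<le> scaled_cond_num M" unfolding s using one f0 by (intro cINF_greatest) auto
  have "bdd_below (f ` pos_diag_mats m)" using f0 by (intro bdd_belowI[of _ 0]) auto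
  then have "scaled_cond_num M \<le> f (1\<^sub>m m)" unfolding s using one by (rule cINF_lower)
  also have "\<dots> = frob_norm M / sigma_min M" using M by (simp add: f_def)
  also have "\<dots> \<le> (sqrt m * sigma_max M) / sigma_min M"
  proof (rule divide_right_mono)
    have col: "nrm n (\<lambda>i. M $$ (i, j)) \<le> sigma_max M" if j: "j < m" for j
    proof -
      define e where "e i = (if i = j then 1 else 0 :: real)" for i
      have "(nrm m e)\<^sup>2 = (\<Sum>i<m. if i = j then 1 else 0)"
        unfolding nrm_sq by (intro sum.cong) (auto simp: e_def)
      then have "nrm m e = 1" using j power2_eq_iff_nonneg[of "nrm m e" 1] by simp
      moreover have "(\<Sum>l<m. e l * M $$ (i, l)) = M $$ (i, j)" for i
      proof -
        have "(\<Sum>l<m. e l * M $$ (i, l)) = (\<Sum>l<m. if l = j then M $$ (i, j) else 0)"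
          by (intro sum.cong) (auto simp: e_def)
        then show ?thesis using j by simp
      qed
      ultimately show ?thesis using le_sigma_max[OF M m, of e] by simp
    qed
    have "frob_norm M \<le> nrm m (\<lambda>_. sigma_max M)"
      unfolding frob_norm_columns[OF M] by (intro L2_set_mono) (use col in auto)
    moreover have "0 \<le> sigma_max M" using col[OF m] by (rule order_trans[rotated]) simp
    ultimately show "frob_norm M \<le> sqrt m * sigma_max M" by (simp add: L2_set_constant)
  qed (rule sigma_min_nonneg[OF M m])
  finally show "scaled_cond_num M \<le> sqrt m * cond_num M" by (simp add: cond_num_def)
qed

section \<open>The inverse of a unit lower triangular matrix\<close>

lemma unit_lower_inverse:
  fixes L :: "real mat"
  assumes L: "L \<in> carrier_mat k k"
    and strict: "\<And>i j. i \<le> j \<Longrightarrow> j < k \<Longrightarrow> L $$ (i, j) = 0"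
  shows "\<exists>T. mat_inverse (1\<^sub>m k + L) = Some T \<and> T \<in> carrier_mat k k \<and>
    (1\<^sub>m k + L) * T = 1\<^sub>m k \<and> T * (1\<^sub>m k + L) = 1\<^sub>m k"
proof -
  have A: "1\<^sub>m k + L \<in> carrier_mat k k" using L by simp
  have "det (1\<^sub>m k + L) = prod_list (diag_mat (1\<^sub>m k + L))"
    by (rule det_lower_triangular[OF _ A]) (use L strict in auto)
  also have "diag_mat (1\<^sub>m k + L) = replicate k 1"
    using L strict by (auto simp: diag_mat_def map_nth intro!: nth_equalityI)
  finally have "det (1\<^sub>m k + L) \<noteq> 0" by simp
  then have "1\<^sub>m k + L \<in> Units (ring_mat TYPE(real) k ())" by (rule det_non_zero_imp_unit[OF A])
  then obtain T where "mat_inverse (1\<^sub>m k + L) = Some T"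
    using mat_inverse(1)[OF A, where b = "()"] by (cases "mat_inverse (1\<^sub>m k + L)") auto
  then show ?thesis using mat_inverse(2)[OF A] by blast
qed

text \<open>Forward substitution: an entry of \<open>T\<close> is in modulus at most \<open>1\<close> plus the sum of the
  moduli of those above it.\<close>

lemma unit_lower_inverse_entries:
  fixes L :: "real mat"
  assumes L: "L \<in> carrier_mat k k" and T: "T \<in> carrier_mat k k"
    and strict: "\<And>i j. i \<le> j \<Longrightarrow> j < k \<Longrightarrow> L $$ (i, j) = 0"
    and le1: "\<And>i j. i < k \<Longrightarrow> j < k \<Longrightarrow> \<bar>L $$ (i, j)\<bar> \<le> 1"
    and inv: "(1\<^sub>m k + L) * T = 1\<^sub>m k" and j: "j < k"
  shows "i < k \<Longrightarrow> \<bar>T $$ (i, j)\<bar> \<le> 2 ^ i"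
proof (induction i rule: less_induct)
  case (less i)
  have LT: "L * T \<in> carrier_mat k k" using L T by simp
  have "(1\<^sub>m k + L) * T = T + L * T" using L T by (simp add: add_mult_distrib_mat[of _ k k])
  with inv have "(T + L * T) $$ (i, j) = (1\<^sub>m k) $$ (i, j)" by simp
  then have "T $$ (i, j) + (L * T) $$ (i, j) = (if i = j then 1 else 0)"
    using less.prems j L T by simp
  moreover have "(L * T) $$ (i, j) = (\<Sum>l<k. L $$ (i, l) * T $$ (l, j))"
    using L T less.prems j by (auto simp: scalar_prod_def atLeast0LessThan intro!: sum.cong)
  moreover have "(\<Sum>l<k. L $$ (i, l) * T $$ (l, j)) = (\<Sum>l<i. L $$ (i, l) * T $$ (l, j))"
    using less.prems strict by (intro sum.mono_neutral_right) (auto simp: not_less)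
  ultimately have "\<bar>T $$ (i, j)\<bar> \<le> 1 + \<bar>\<Sum>l<i. L $$ (i, l) * T $$ (l, j)\<bar>"
    by (auto split: if_splits)
  also have "\<bar>\<Sum>l<i. L $$ (i, l) * T $$ (l, j)\<bar> \<le> (\<Sum>l<i. \<bar>L $$ (i, l)\<bar> * \<bar>T $$ (l, j)\<bar>)"
    by (rule order_trans[OF sum_abs]) (simp add: abs_mult)
  also have "\<dots> \<le> (\<Sum>l<i. 1 * 2 ^ l)"
    using less le1 by (intro sum_mono mult_mono) auto
  also have "1 + (\<Sum>l<i. 1 * 2 ^ l :: real) = 2 ^ i"
    by (induction i) auto
  finally show ?case by simp
qed

lemma mult_entry_bound:
  fixes M N :: "real mat"
  assumes M: "M \<in> carrier_mat k k" and N: "N \<in> carrier_mat k k" and XY: "0 \<le> X"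
    and "\<And>l. l < k \<Longrightarrow> \<bar>M $$ (i, l)\<bar> \<le> X" "\<And>l. l < k \<Longrightarrow> \<bar>N $$ (l, j)\<bar> \<le> Y"
    and ij: "i < k" "j < k"
  shows "\<bar>(M * N) $$ (i, j)\<bar> \<le> k * X * Y"
proof -
  have "(M * N) $$ (i, j) = (\<Sum>l<k. M $$ (i, l) * N $$ (l, j))"
    using M N ij by (auto simp: scalar_prod_def atLeast0LessThan intro!: sum.cong)
  also have "\<bar>\<dots>\<bar> \<le> (\<Sum>l<k. \<bar>M $$ (i, l)\<bar> * \<bar>N $$ (l, j)\<bar>)"
    by (rule order_trans[OF sum_abs]) (simp add: abs_mult)
  also have "\<dots> \<le> (\<Sum>l<k. X * Y)" using assms by (intro sum_mono mult_mono) auto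
  finally show ?thesis by (simp add: mult.assoc)
qed

text \<open>The remainder of the linearised inverse is exactly \<open>T L\<^sup>2\<close>.\<close>

lemma unit_lower_inverse_expansion:
  fixes L :: "real mat"
  assumes L: "L \<in> carrier_mat k k"
    and strict: "\<And>i j. i \<le> j \<Longrightarrow> j < k \<Longrightarrow> L $$ (i, j) = 0"
    and le1: "\<And>i j. i < k \<Longrightarrow> j < k \<Longrightarrow> \<bar>L $$ (i, j)\<bar> \<le> 1"
  shows "\<exists>T E. mat_inverse (1\<^sub>m k + L) = Some T \<and> E \<in> carrier_mat k k \<and> T = 1\<^sub>m k - L + E \<and>
    frob_norm E \<le> real k ^ 3 * 2 ^ k * (frob_norm L)\<^sup>2"
proof -
  obtain T where T: "mat_inverse (1\<^sub>m k + L) = Some T" "T \<in> carrier_mat k k"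
    and TL: "(1\<^sub>m k + L) * T = 1\<^sub>m k" "T * (1\<^sub>m k + L) = 1\<^sub>m k"
    using unit_lower_inverse[OF L strict] by blast
  define E where "E = T * (L * L)"
  have LL: "L * L \<in> carrier_mat k k" using L by simp
  have E: "E \<in> carrier_mat k k" using T L by (simp add: E_def)
  have TLc: "T * L \<in> carrier_mat k k" using T L by simp
  have "T * (1\<^sub>m k + L) = T * 1\<^sub>m k + T * L"
    using T(2) L by (intro mult_add_distrib_mat) auto
  then have t1: "T + T * L = 1\<^sub>m k" using TL(2) T(2) by simp
  have "(T + T * L) * L = L" unfolding t1 using L by simp
  then have t2: "T * L + E = L"
    using T L TLc by (simp add: add_mult_distrib_mat[of _ k k] E_def assoc_mult_mat[of _ k k _ k _ k])
  have "T = 1\<^sub>m k - L + E"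
  proof (rule eq_matI)
    fix i j assume "i < dim_row (1\<^sub>m k - L + E)" "j < dim_col (1\<^sub>m k - L + E)"
    then have ij: "i < k" "j < k" using E by auto
    have "T $$ (i, j) + (T * L) $$ (i, j) = (1\<^sub>m k) $$ (i, j)"
      using arg_cong[OF t1, of "\<lambda>M. M $$ (i, j)"] ij T L by simp
    moreover have "(T * L) $$ (i, j) + E $$ (i, j) = L $$ (i, j)"
      using arg_cong[OF t2, of "\<lambda>M. M $$ (i, j)"] ij E T L by simp
    moreover have "(1\<^sub>m k - L + E) $$ (i, j) = (1\<^sub>m k) $$ (i, j) - L $$ (i, j) + E $$ (i, j)"
      using ij L E by simp
    ultimately show "T $$ (i, j) = (1\<^sub>m k - L + E) $$ (i, j)" by linarith
  qed (use T E in auto)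
  moreover have "frob_norm E \<le> real k ^ 3 * 2 ^ k * (frob_norm L)\<^sup>2"
  proof -
    define X where "X = frob_norm L"
    have X0: "0 \<le> X" by (simp add: X_def frob_norm_nonneg)
    have LLb: "\<bar>(L * L) $$ (i, j)\<bar> \<le> k * X * X" if "i < k" "j < k" for i j
      using mult_entry_bound[OF L L X0, of i j X] entry_le_frob_norm[OF L] that by (simp add: X_def)
    have Tb: "\<bar>T $$ (i, j)\<bar> \<le> 2 ^ k" if "i < k" "j < k" for i j
      using unit_lower_inverse_entries[OF L T(2) strict le1 TL(1) that(2,1)]
        power_increasing[of i k "2::real"] that by linarith
    have "\<bar>E $$ (i, j)\<bar> \<le> real k * 2 ^ k * (real k * X * X)" if "i < k" "j < k" for i j
      unfolding E_def using Tb LLb that by (intro mult_entry_bound[OF T(2) LL]) auto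
    then have "frob_norm E \<le> real k * (real k * 2 ^ k * (real k * X * X))"
      using X0 by (intro frob_norm_le_entries[OF E]) auto
    then show ?thesis by (simp add: X_def power2_eq_square power3_eq_cube mult_ac)
  qed
  ultimately show ?thesis using T(1) E by blast
qed


section \<open>The Arnoldi process\<close>

lemma arnoldi_mat_carrier:
  "length W = k \<Longrightarrow> b \<in> carrier_vec n \<Longrightarrow> arnoldi_mat b W \<in> carrier_mat n (Suc k)"
  by (auto simp: arnoldi_mat_def)

lemma arnoldi_mat_index:
  "length W = k \<Longrightarrow> b \<in> carrier_vec n \<Longrightarrow> i < n \<Longrightarrow> j < Suc k \<Longrightarrow>
    arnoldi_mat b W $$ (i, j) = (b # W) ! j $ i"
  by (simp add: arnoldi_mat_def mat_of_cols_def)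

lemma fl_arnoldi_nearly_unit:
  assumes run: "fl_arnoldi \<epsilon> A b k V W" "A \<in> carrier_mat n n" "b \<in> carrier_vec n"
    and eps: "0 \<le> \<epsilon>" and small: "step_const n * \<epsilon> \<le> 1 / 2" and j: "j \<le> k"
  shows "nearly_unit \<epsilon> n (V ! j)"
proof -
  obtain u where "dim_vec u = n" "fl_normalize \<epsilon> u (V ! j)"
    using fl_arnoldi_columns[OF run] j by blast
  then show ?thesis using fl_normalize_nearly_unit(1) eps small by blast
qed

text \<open>The column estimates, with \<open>r\<close> extended by zeros to a full column of an upper triangular
  matrix.\<close>

lemma fl_arnoldi_factorization:
  assumes run: "fl_arnoldi \<epsilon> A b k V W" "A \<in> carrier_mat n n" "b \<in> carrier_vec n"
    and eps: "0 \<le> \<epsilon>" and small: "step_const n * \<epsilon> \<le> 1 / 2" and j: "j \<le> k"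
  shows "\<exists>r. r j \<noteq> 0 \<and> (\<forall>l. j < l \<longrightarrow> r l = 0) \<and>
    nrm n (\<lambda>i. (b # W) ! j $ i - (\<Sum>l<Suc k. r l * dir n (V ! l) i))
      \<le> column_const n k * \<epsilon> * nrm n (($) ((b # W) ! j)) \<and>
    (\<forall>i<Suc k. \<bar>\<Sum>l<Suc k. (if i < l then ip n (dir n (V ! i)) (dir n (V ! l)) else 0) * r l\<bar>
      \<le> column_const n k * \<epsilon> * nrm n (($) ((b # W) ! j)))"
proof -
  define w where "w = (b # W) ! j"
  note cols = fl_arnoldi_columns[OF run]
  obtain u where u: "dim_vec u = n" "fl_mgs \<epsilon> (take j V) w u" "fl_normalize \<epsilon> u (V ! j)"
    using cols j unfolding w_def by blast
  have lV: "length V = Suc k" using cols by blast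
  have near: "\<forall>v\<in>set (take j V). nearly_unit \<epsilon> n v"
    using fl_arnoldi_nearly_unit[OF run eps small] j lV by (auto simp: in_set_conv_nth)
  have dw: "dim_vec w = n" using fl_mgs_dim[OF u(2)] u(1) by simp
  have V: "(take j V @ [V ! j]) ! l = V ! l" if "l \<le> j" for l
    using that j lV by (simp add: take_Suc_conv_app_nth[symmetric])
  define e where "e = column_const n k * \<epsilon> * nrm n (($) w)"
  have e0: "0 \<le> e" using column_const_pos[of n k] eps by (simp add: e_def)
  have "\<exists>r. r j \<noteq> 0 \<and> nrm n (\<lambda>i. w $ i - (\<Sum>l\<le>j. r l * dir n (V ! l) i)) \<le> e \<and>
      (\<forall>i<j. \<bar>\<Sum>l\<le>j. if i < l then r l * ip n (dir n (V ! i)) (dir n (V ! l)) else 0\<bar> \<le> e)"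
    using mgs_column_error[OF u(2) dw near u(3) eps small _ j] j lV V
    by (simp add: e_def cong: if_cong)
  then obtain r where r: "r j \<noteq> 0" "nrm n (\<lambda>i. w $ i - (\<Sum>l\<le>j. r l * dir n (V ! l) i)) \<le> e"
    "\<And>i. i < j \<Longrightarrow> \<bar>\<Sum>l\<le>j. if i < l then r l * ip n (dir n (V ! i)) (dir n (V ! l)) else 0\<bar> \<le> e"
    by blast
  define r' where "r' l = (if l \<le> j then r l else 0)" for l
  have ext: "(\<Sum>l<Suc k. F l * r' l) = (\<Sum>l\<le>j. F l * r l)" for F
  proof -
    have "(\<Sum>l<Suc k. F l * r' l) = (\<Sum>l\<le>j. F l * r' l)"
      using j by (intro sum.mono_neutral_right) (auto simp: r'_def)
    then show ?thesis by (simp add: r'_def)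
  qed
  have A: "nrm n (\<lambda>i. w $ i - (\<Sum>l<Suc k. r' l * dir n (V ! l) i)) \<le> e"
    using r(2) ext[of "\<lambda>l. dir n (V ! l) i" for i] by (simp add: mult.commute del: sum.lessThan_Suc)
  have B: "\<bar>\<Sum>l<Suc k. (if i < l then ip n (dir n (V ! i)) (dir n (V ! l)) else 0) * r' l\<bar> \<le> e" for i
  proof (cases "i < j")
    case True
    have "(\<Sum>l\<le>j. (if i < l then ip n (dir n (V ! i)) (dir n (V ! l)) else 0) * r l)
        = (\<Sum>l\<le>j. if i < l then r l * ip n (dir n (V ! i)) (dir n (V ! l)) else 0)"
      by (intro sum.cong) auto
    then show ?thesis unfolding ext using r(3)[OF True] by simp
  next
    case False
    then have "(\<Sum>l\<le>j. (if i < l then ip n (dir n (V ! i)) (dir n (V ! l)) else 0) * r l) = 0"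
      by (intro sum.neutral) auto
    then show ?thesis unfolding ext using e0 by simp
  qed
  have "r' j \<noteq> 0" "\<forall>l. j < l \<longrightarrow> r' l = 0" using r(1) by (auto simp: r'_def)
  with A B show ?thesis unfolding e_def w_def by blast
qed

text \<open>The errors in each column are relative to the norm of that column, so the estimates survive
  any column scaling \<open>D\<close>, and \<open>D\<close> can be chosen after the run. This is why the scaled condition
  number governs the loss of orthogonality.\<close>

lemma fl_arnoldi_loss_of_orthogonality:
  assumes run: "fl_arnoldi \<epsilon> A b k V W" "A \<in> carrier_mat n n" "b \<in> carrier_vec n"
    and pos: "0 < \<epsilon>" and small: "step_const n * \<epsilon> \<le> 1 / 2"
    and \<sigma>: "sigma_min (arnoldi_mat b W) \<noteq> 0" and ij: "i < j" "j \<le> k"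
  shows "\<bar>ip n (dir n (V ! i)) (dir n (V ! j))\<bar>
    \<le> 2 * real (Suc k) * column_const n k * \<epsilon> * scaled_cond_num (arnoldi_mat b W)"
proof -
  have eps: "0 \<le> \<epsilon>" using pos by simp
  define B where "B = arnoldi_mat b W"
  define m where "m = Suc k"
  define q where "q l = dir n (V ! l)" for l
  define a where "a j = ($) ((b # W) ! j)" for j
  define \<delta> where "\<delta> = column_const n k * \<epsilon>"
  have \<delta>0: "0 \<le> \<delta>" using column_const_pos[of n k] eps by (simp add: \<delta>_def)
  have lW: "length W = k" using fl_arnoldi_columns[OF run] by blast
  have B: "B \<in> carrier_mat n m" unfolding B_def m_def by (rule arnoldi_mat_carrier[OF lW run(3)])
  have m0: "0 < m" by (simp add: m_def)
  have \<sigma>B: "sigma_min B \<noteq> 0" using \<sigma> by (simp add: B_def)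
  have Bij: "B $$ (i, j) = a j i" if "i < n" "j < m" for i j
    using arnoldi_mat_index[OF lW run(3)] that by (simp add: B_def a_def m_def)
  define R where "R j r \<longleftrightarrow> r j \<noteq> 0 \<and> (\<forall>l. j < l \<longrightarrow> r l = 0) \<and>
     nrm n (\<lambda>i. a j i - (\<Sum>l<m. r l * q l i)) \<le> \<delta> * nrm n (a j) \<and>
    (\<forall>i<m. \<bar>\<Sum>l<m. (if i < l then ip n (q i) (q l) else 0) * r l\<bar> \<le> \<delta> * nrm n (a j))" for j r
  have "\<exists>r. R j r" if "j < m" for j
    using fl_arnoldi_factorization[OF run eps small, of j] that
    unfolding R_def m_def \<delta>_def a_def q_def less_Suc_eq_le by blast
  then obtain r where R: "\<And>j. j < m \<Longrightarrow> R j (r j)" by metis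
  have r: "r j j \<noteq> 0" "\<And>l. j < l \<Longrightarrow> r j l = 0"
    "nrm n (\<lambda>i. a j i - (\<Sum>l<m. r j l * q l i)) \<le> \<delta> * nrm n (a j)"
    "\<And>i. i < m \<Longrightarrow>
      \<bar>\<Sum>l<m. (if i < l then ip n (q i) (q l) else 0) * r j l\<bar> \<le> \<delta> * nrm n (a j)"
    if "j < m" for j
    using R[OF that] by (simp_all add: R_def)
  define x where "x = \<bar>ip n (q i) (q j)\<bar>"
  have bound: "x \<le> 2 * real m * \<delta> * (frob_norm (B * D) / sigma_min (B * D))" if D: "D \<in> pos_diag_mats m" for D
  proof -
    define d where "d l = D $$ (l, l)" for l
    have d: "0 < d l" if "l < m" for l using D that by (auto simp: d_def pos_diag_mats_def)
    have BD: "B * D \<in> carrier_mat n m" using B D by (auto simp: pos_diag_mats_def)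
    have BDij: "(B * D) $$ (i, l) = d l * a l i" if "i < n" "l < m" for i l
      using mult_diag_index[OF B D that] Bij[OF that] by (simp add: d_def)
    have "x \<le> 2 * real m * \<delta> * nrm m (\<lambda>l. d l * nrm n (a l)) / sigma_min (B * D)"
      unfolding x_def
    proof (rule loss_of_orthogonality[where r = "\<lambda>l j. r j l" and q = q and a = a and d = d
          and m = m and n = n and \<delta> = \<delta> and i = i and j = j])
      show "nrm n (q l) = 1" if "l < m" for l
        using fl_arnoldi_nearly_unit[OF run eps small, of l] that
        by (simp add: m_def q_def nearly_unit_def)
      show "0 < sigma_min (B * D)" by (rule sigma_min_mult_diag_pos[OF B m0 \<sigma>B D])
      show "sigma_min (B * D) * nrm m y \<le> nrm n (\<lambda>i. \<Sum>l<m. y l * (d l * a l i))" for y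
      proof -
        have "nrm n (\<lambda>i. \<Sum>l<m. y l * (B * D) $$ (i, l)) = nrm n (\<lambda>i. \<Sum>l<m. y l * (d l * a l i))"
          by (intro L2_set_cong sum.cong refl) (simp add: BDij)
        then show ?thesis using sigma_min_le[OF BD m0, of y] by simp
      qed
      show "i < j" "j < m" using ij by (auto simp: m_def)
      show "r j l = 0" if "j < l" "l < m" for l j using r(2)[of j l] that by simp
      show "nrm n (\<lambda>i. a j i - (\<Sum>l<m. r j l * q l i)) \<le> \<delta> * nrm n (a j)" if "j < m" for j
        by (rule r(3)[OF that])
      show "\<bar>\<Sum>l<m. (if i < l then ip n (q i) (q l) else 0) * r j l\<bar> \<le> \<delta> * nrm n (a j)"
        if "i < m" "j < m" for i j by (rule r(4)[OF that(2,1)])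
    qed (use r(1) d \<delta>0 in simp_all)
    also have "nrm m (\<lambda>l. d l * nrm n (a l)) = frob_norm (B * D)"
    proof -
      have "nrm n (\<lambda>i. (B * D) $$ (i, l)) = d l * nrm n (a l)" if l: "l < m" for l
      proof -
        have "nrm n (\<lambda>i. (B * D) $$ (i, l)) = nrm n (\<lambda>i. d l * a l i)"
          by (intro L2_set_cong refl) (simp add: BDij l)
        then show ?thesis using d[OF l] by (simp add: nrm_scale)
      qed
      then show ?thesis unfolding frob_norm_columns[OF BD] by (intro L2_set_cong) auto
    qed
    finally show ?thesis by simp
  qed
  define t where "t = 2 * real m * \<delta>"
  have t: "0 < t" using pos column_const_pos[of n k] m0 by (simp add: t_def \<delta>_def)
  have "x / t \<le> scaled_cond_num B"
    unfolding scaled_cond_num_def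
  proof (rule cINF_greatest)
    have "1\<^sub>m m \<in> pos_diag_mats m" by (auto simp: pos_diag_mats_def diagonal_mat_def)
    then show "pos_diag_mats (dim_col B) \<noteq> {}" using B by auto
    show "x / t \<le> frob_norm (B * D) / sigma_min (B * D)" if "D \<in> pos_diag_mats (dim_col B)" for D
    proof -
      have "x \<le> t * (frob_norm (B * D) / sigma_min (B * D))"
        unfolding t_def using that B by (intro bound) auto
      then show ?thesis using t by (simp add: pos_divide_le_eq mult.commute)
    qed
  qed
  then have "x \<le> t * scaled_cond_num B" using t by (simp add: pos_divide_le_eq mult.commute)
  then show ?thesis by (simp add: x_def q_def t_def \<delta>_def B_def m_def mult_ac)
qed

lemma normalized_krylov_mat_carrier:
  "length V = Suc k \<Longrightarrow> normalized_krylov_mat n k V \<in> carrier_mat n k"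
  using mat_of_cols_carrier(1)[of n "map unit_vec_of (take k V)"]
  by (simp add: normalized_krylov_mat_def min_absorb2)

lemma normalized_krylov_mat_index:
  assumes "length V = Suc k" "dim_vec (V ! j) = n" "i < n" "j < k"
  shows "normalized_krylov_mat n k V $$ (i, j) = dir n (V ! j) i"
  using assms
  by (simp add: normalized_krylov_mat_def mat_of_cols_def unit_vec_of_def dir_def norm2_eq_nrm)

theorem mainTheorem1:
  fixes n :: nat
  shows "\<exists>c>0. \<forall>k. \<exists>(C1 :: real) (Cp :: nat \<Rightarrow> real) (C2 :: real).
    \<forall>(\<epsilon> :: real) A b V W.
      0 < \<epsilon> \<longrightarrow> c * \<epsilon> < 1 \<longrightarrow>
      A \<in> carrier_mat n n \<longrightarrow> b \<in> carrier_vec n \<longrightarrow>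
      fl_arnoldi \<epsilon> A b k V W \<longrightarrow>
      sigma_min (arnoldi_mat b W) \<noteq> 0 \<longrightarrow>
      (let B = arnoldi_mat b W;
           Vt = normalized_krylov_mat n k V;
           L = strict_lower_part (transpose_mat Vt * Vt)
       in transpose_mat Vt * Vt = 1\<^sub>m k + L + transpose_mat L \<and>
          frob_norm L \<le> C1 * \<epsilon> * scaled_cond_num B \<and>
          (\<forall>p. frob_norm L ^ p \<le> Cp p * \<epsilon> ^ p * scaled_cond_num B ^ p) \<and>
          (\<exists>T E. mat_inverse (1\<^sub>m k + L) = Some T \<and>
                 E \<in> carrier_mat k k \<and> T = 1\<^sub>m k - L + E \<and>
                 frob_norm E \<le> C2 * \<epsilon>\<^sup>2 * (cond_num B)\<^sup>2))"
proof -
  define C1 where "C1 k = real k * (2 * real (Suc k) * column_const n k)" for k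
  define C2 where "C2 k = real k ^ 3 * 2 ^ k * ((C1 k)\<^sup>2 * real (Suc k))" for k
  have C1: "0 \<le> C1 k" for k using column_const_pos[of n k] by (simp add: C1_def)
  have main: "transpose_mat Vt * Vt = 1\<^sub>m k + L + transpose_mat L \<and>
          frob_norm L \<le> C1 k * \<epsilon> * scaled_cond_num B \<and>
          (\<forall>p. frob_norm L ^ p \<le> C1 k ^ p * \<epsilon> ^ p * scaled_cond_num B ^ p) \<and>
          (\<exists>T E. mat_inverse (1\<^sub>m k + L) = Some T \<and>
                 E \<in> carrier_mat k k \<and> T = 1\<^sub>m k - L + E \<and>
                 frob_norm E \<le> C2 k * \<epsilon>\<^sup>2 * (cond_num B)\<^sup>2)"
    if eps: "0 < \<epsilon>" "2 * step_const n * \<epsilon> < 1" and A: "A \<in> carrier_mat n n"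
      and b: "b \<in> carrier_vec n" and run: "fl_arnoldi \<epsilon> A b k V W"
      and \<sigma>: "sigma_min (arnoldi_mat b W) \<noteq> 0"
      and B_def: "B = arnoldi_mat b W" and Vt_def: "Vt = normalized_krylov_mat n k V"
      and L_def: "L = strict_lower_part (transpose_mat Vt * Vt)"
    for k \<epsilon> A b V W B Vt L
  proof -
    have small: "step_const n * \<epsilon> \<le> 1 / 2" and eps0: "0 \<le> \<epsilon>" using eps by auto
    define G where "G = transpose_mat Vt * Vt"
    define \<kappa> where "\<kappa> = scaled_cond_num B"
    note cols = fl_arnoldi_columns[OF run A b]
    have Vt: "Vt \<in> carrier_mat n k"
      unfolding Vt_def using cols by (intro normalized_krylov_mat_carrier) blast
    have G: "G \<in> carrier_mat k k" using Vt by (simp add: G_def)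
    have near: "nearly_unit \<epsilon> n (V ! j)" if "j \<le> k" for j
      by (rule fl_arnoldi_nearly_unit[OF run A b eps0 small that])
    have Vtij: "Vt $$ (i, j) = dir n (V ! j) i" if "i < n" "j < k" for i j
      unfolding Vt_def using cols near[of j] that
      by (intro normalized_krylov_mat_index) (auto simp: nearly_unit_def)
    have Gij: "G $$ (i, j) = ip n (dir n (V ! i)) (dir n (V ! j))" if "i < k" "j < k" for i j
      unfolding G_def gram_index[OF Vt that] using that by (simp add: ip_def Vtij)
    have Gsym: "G $$ (i, j) = G $$ (j, i)" if "i < k" "j < k" for i j
      using that by (simp add: Gij ip_def mult.commute)
    have Gdiag: "G $$ (i, i) = 1" if "i < k" for i
      using that near[of i] by (simp add: Gij ip_self nearly_unit_def)
    have L: "L \<in> carrier_mat k k" using G by (simp add: L_def G_def[symmetric] strict_lower_part_def)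
    have Lij: "L $$ (i, j) = (if j < i then G $$ (i, j) else 0)" if "i < k" "j < k" for i j
      using that G by (simp add: L_def G_def[symmetric] strict_lower_part_def)
    have split: "G = 1\<^sub>m k + L + transpose_mat L"
    proof (rule eq_matI)
      fix i j assume "i < dim_row (1\<^sub>m k + L + transpose_mat L)" "j < dim_col (1\<^sub>m k + L + transpose_mat L)"
      then have ij: "i < k" "j < k" using L by auto
      then show "G $$ (i, j) = (1\<^sub>m k + L + transpose_mat L) $$ (i, j)"
        using L Gdiag[of i] Gsym[of i j] by (cases i j rule: linorder_cases) (auto simp: Lij)
    qed (use G L in auto)
    have B: "B \<in> carrier_mat n (Suc k)"
      unfolding B_def using cols b by (intro arnoldi_mat_carrier) auto
    have \<sigma>B: "sigma_min B \<noteq> 0" using \<sigma> by (simp add: B_def)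
    have \<kappa>0: "0 \<le> \<kappa>" unfolding \<kappa>_def by (rule scaled_cond_num_le(2)[OF B _ \<sigma>B]) simp
    have \<kappa>_le: "\<kappa> \<le> sqrt (Suc k) * cond_num B"
      unfolding \<kappa>_def by (rule scaled_cond_num_le(1)[OF B _ \<sigma>B]) simp
    define e where "e = 2 * real (Suc k) * column_const n k * \<epsilon> * \<kappa>"
    have e0: "0 \<le> e" using \<kappa>0 eps column_const_pos[of n k] by (simp add: e_def)
    have "\<bar>L $$ (i, j)\<bar> \<le> e" if "i < k" "j < k" for i j
    proof (cases "j < i")
      case True
      then have "\<bar>G $$ (j, i)\<bar> \<le> e"
        using fl_arnoldi_loss_of_orthogonality[OF run A b eps(1) small \<sigma> True] that
        by (simp add: Gij e_def \<kappa>_def B_def)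
      then show ?thesis using True that Gsym[of i j] by (simp add: Lij)
    qed (use that e0 in \<open>simp add: Lij\<close>)
    then have "frob_norm L \<le> k * e" by (rule frob_norm_le_entries[OF L e0])
    then have Lb: "frob_norm L \<le> C1 k * \<epsilon> * \<kappa>" by (simp add: C1_def e_def mult_ac)
    have "frob_norm L ^ p \<le> C1 k ^ p * \<epsilon> ^ p * \<kappa> ^ p" for p
      using power_mono[OF Lb frob_norm_nonneg, of p] by (simp add: power_mult_distrib)
    moreover have "\<exists>T E. mat_inverse (1\<^sub>m k + L) = Some T \<and> E \<in> carrier_mat k k \<and>
       T = 1\<^sub>m k - L + E \<and> frob_norm E \<le> C2 k * \<epsilon>\<^sup>2 * (cond_num B)\<^sup>2"
    proof -
      have "\<bar>L $$ (i, j)\<bar> \<le> 1" if "i < k" "j < k" for i j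
        using that near[of i] near[of j] ip_bound[of n "dir n (V ! i)" "dir n (V ! j)"]
        by (auto simp: Lij Gij nearly_unit_def)
      then obtain T E where TE: "mat_inverse (1\<^sub>m k + L) = Some T" "E \<in> carrier_mat k k"
        "T = 1\<^sub>m k - L + E" "frob_norm E \<le> real k ^ 3 * 2 ^ k * (frob_norm L)\<^sup>2"
        using unit_lower_inverse_expansion[OF L] by (auto simp: Lij)
      have "(frob_norm L)\<^sup>2 \<le> (C1 k * \<epsilon> * \<kappa>)\<^sup>2" by (rule power_mono[OF Lb frob_norm_nonneg])
      also have "\<dots> = (C1 k)\<^sup>2 * \<epsilon>\<^sup>2 * \<kappa>\<^sup>2" by (simp add: power_mult_distrib)
      also have "\<kappa>\<^sup>2 \<le> (sqrt (Suc k) * cond_num B)\<^sup>2" by (rule power_mono[OF \<kappa>_le \<kappa>0])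
      also have "\<dots> = real (Suc k) * (cond_num B)\<^sup>2" by (simp add: power_mult_distrib)
      finally have "real k ^ 3 * 2 ^ k * (frob_norm L)\<^sup>2
          \<le> real k ^ 3 * 2 ^ k * ((C1 k)\<^sup>2 * \<epsilon>\<^sup>2 * (real (Suc k) * (cond_num B)\<^sup>2))"
        by (intro mult_left_mono) (simp_all add: mult_left_mono)
      also have "\<dots> = C2 k * \<epsilon>\<^sup>2 * (cond_num B)\<^sup>2" by (simp only: C2_def mult_ac)
      finally have "frob_norm E \<le> C2 k * \<epsilon>\<^sup>2 * (cond_num B)\<^sup>2"
        by (rule order_trans[OF TE(4)])
      then show ?thesis using TE(1-3) by blast
    qed
    ultimately show ?thesis using split Lb unfolding G_def \<kappa>_def by blast
  qed
  show ?thesis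
  proof (rule exI[of _ "2 * step_const n"], intro conjI allI)
    show "0 < 2 * step_const n" using const_pos[of n] by simp
    fix k
    show "\<exists>(C1 :: real) (Cp :: nat \<Rightarrow> real) (C2 :: real).
    \<forall>(\<epsilon> :: real) A b V W.
      0 < \<epsilon> \<longrightarrow> 2 * step_const n * \<epsilon> < 1 \<longrightarrow>
      A \<in> carrier_mat n n \<longrightarrow> b \<in> carrier_vec n \<longrightarrow>
      fl_arnoldi \<epsilon> A b k V W \<longrightarrow>
      sigma_min (arnoldi_mat b W) \<noteq> 0 \<longrightarrow>
      (let B = arnoldi_mat b W;
           Vt = normalized_krylov_mat n k V;
           L = strict_lower_part (transpose_mat Vt * Vt)
       in transpose_mat Vt * Vt = 1\<^sub>m k + L + transpose_mat L \<and>
          frob_norm L \<le> C1 * \<epsilon> * scaled_cond_num B \<and>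
          (\<forall>p. frob_norm L ^ p \<le> Cp p * \<epsilon> ^ p * scaled_cond_num B ^ p) \<and>
          (\<exists>T E. mat_inverse (1\<^sub>m k + L) = Some T \<and>
                 E \<in> carrier_mat k k \<and> T = 1\<^sub>m k - L + E \<and>
                 frob_norm E \<le> C2 * \<epsilon>\<^sup>2 * (cond_num B)\<^sup>2))"
      unfolding Let_def
      by (rule exI[of _ "C1 k"], rule exI[of _ "\<lambda>p. C1 k ^ p"], rule exI[of _ "C2 k"],
          intro allI impI, rule main[OF _ _ _ _ _ _ refl refl refl])
  qed
qed

end
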